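(* There exists a universal constant $c_2 > 0$ such that for every function $f:\mathcal{X}\times\mathcal{Y}\to\{0,1\}$ and every positive integer $n$, $$\mathrm{IC}(f^{\oplus n}, 1/10) \leq c_2 n \cdot \mathrm{IC}(f, n^{-1}).$$
   Context: Two-player randomized communication: Alice gets $x$, Bob gets $y$; a protocol $\pi$ uses public randomness $M^0$ and private randomness and produces messages $M^+=(M^1,\dots,M^r)$, Alice sending odd-indexed and Bob even-indexed messages, each depending only on the sender's input, previous messages and randomness; the last message is the output. For an input distribution $\mu$, with $(X,Y)\sim\mu$ and transcript $\mathbf{M}=(M^0,M^+)$, $\mathrm{IC}_\mu(\pi)=I(\mathbf{M}:X\mid Y M^0)+I(\mathbf{M}:Y\mid X M^0)$. $\mathrm{IC}(g,\varepsilon)$ is the infimum, over protocols $\pi$ that output $g(x,y)$ with probability at least $1-\varepsilon$ on every input, of $\max_\mu \mathrm{IC}_\mu(\pi)$. $f^{\oplus n}(X_1,\dots,X_n,Y_1,\dots,Y_n)=f(X_1,Y_1)\oplus\cdots\oplus f(X_n,Y_n)$, with Alice holding the $X_i$'s and Bob the $Y_i$'s.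
   Formalization: Proved for n ≥ 3 and finite nonempty X, Y (coded as sets of naturals), with discrete randomness; for n = 1, 2 the claim is false, since IC(f,1) = IC(f,1/2) = 0 while for f(x,y) = x on bits IC(f^{⊕n},1/10) > 0. *)

theory Defs
  imports "HOL-Probability.Probability"
begin

(* Messages and random strings are encoded as natural numbers.  The two private random strings
   and the public one are mutually independent.  "alice x r m0 h" is the next message of Alice
   on input x, private randomness r, public randomness m0 and previous messages h; similarly
   for Bob. *)
record ('x, 'y) protocol =
  public_coins :: "nat pmf"
  alice_coins :: "nat pmf"
  bob_coins :: "nat pmf"
  rounds :: nat
  alice :: "'x \<Rightarrow> nat \<Rightarrow> nat \<Rightarrow> nat list \<Rightarrow> nat"
  bob :: "'y \<Rightarrow> nat \<Rightarrow> nat \<Rightarrow> nat list \<Rightarrow> nat"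

(* The list [M^1, ..., M^k].  The messages are numbered from 1, so the odd-numbered message
   M^(k+1), sent by Alice, is the one with k even. *)
primrec messages ::
  "('x, 'y) protocol \<Rightarrow> 'x \<Rightarrow> 'y \<Rightarrow> nat \<Rightarrow> nat \<Rightarrow> nat \<Rightarrow> nat \<Rightarrow> nat list" where
  "messages \<pi> x y m0 ra rb 0 = []"
| "messages \<pi> x y m0 ra rb (Suc k) =
     (let h = messages \<pi> x y m0 ra rb k
      in h @ [if even k then alice \<pi> x ra m0 h else bob \<pi> y rb m0 h])"

(* Distribution of (M^0, [M^1, ..., M^r]) on a fixed input pair. *)
definition transcript :: "('x, 'y) protocol \<Rightarrow> 'x \<Rightarrow> 'y \<Rightarrow> (nat \<times> nat list) pmf" where
  "transcript \<pi> x y =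
     do { m0 \<leftarrow> public_coins \<pi>; ra \<leftarrow> alice_coins \<pi>; rb \<leftarrow> bob_coins \<pi>;
          return_pmf (m0, messages \<pi> x y m0 ra rb (rounds \<pi>)) }"

definition execution ::
  "('x \<times> 'y) pmf \<Rightarrow> ('x, 'y) protocol \<Rightarrow> ('x \<times> 'y \<times> nat \<times> nat list) pmf" where
  "execution \<mu> \<pi> =
     do { (x, y) \<leftarrow> \<mu>; (m0, ms) \<leftarrow> transcript \<pi> x y; return_pmf (x, y, m0, ms) }"

(* I(A : B | C) in bits, for discrete random variables on the probability space p.  The value
   types are countable, so that products of the counting measures are counting measures.
   The library defines conditional mutual information as I(A : (B, C)) - I(A : C), hence the
   first argument should have finite range, whereas B and C may have infinite entropy. *)
definition cond_mutual_info ::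
  "'s pmf \<Rightarrow> ('s \<Rightarrow> 'a::countable) \<Rightarrow> ('s \<Rightarrow> 'b::countable) \<Rightarrow> ('s \<Rightarrow> 'c::countable) \<Rightarrow> real" where
  "cond_mutual_info p A B C =
     prob_space.conditional_mutual_information (measure_pmf p) 2
       (count_space UNIV) (count_space UNIV) (count_space UNIV) A B C"

(* I(M : X | Y M^0) + I(M : Y | X M^0), with the (symmetric) mutual information written so that
   the input, which has finite range, comes first. *)
definition information_cost ::
  "('x::countable \<times> 'y::countable) pmf \<Rightarrow> ('x, 'y) protocol \<Rightarrow> real" where
  "information_cost \<mu> \<pi> =
     cond_mutual_info (execution \<mu> \<pi>)
       (\<lambda>(x, y, m0, ms). x) (\<lambda>(x, y, m0, ms). (m0, ms)) (\<lambda>(x, y, m0, ms). (y, m0)) +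
     cond_mutual_info (execution \<mu> \<pi>)
       (\<lambda>(x, y, m0, ms). y) (\<lambda>(x, y, m0, ms). (m0, ms)) (\<lambda>(x, y, m0, ms). (x, m0))"

(* The output is the last message, with the bits 0 and 1 encoding False and True. *)
definition computes_with_error ::
  "('x, 'y) protocol \<Rightarrow> 'x set \<Rightarrow> 'y set \<Rightarrow> ('x \<Rightarrow> 'y \<Rightarrow> bool) \<Rightarrow> real \<Rightarrow> bool" where
  "computes_with_error \<pi> X Y g \<epsilon> \<longleftrightarrow>
     0 < rounds \<pi> \<and>
     (\<forall>x\<in>X. \<forall>y\<in>Y.
        measure_pmf.prob (transcript \<pi> x y) {(m0, ms). last ms = of_bool (g x y)} \<ge> 1 - \<epsilon>)"

(* Only the values of g on X \<times> Y matter. *)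
definition information_complexity ::
  "'x::countable set \<Rightarrow> 'y::countable set \<Rightarrow> ('x \<Rightarrow> 'y \<Rightarrow> bool) \<Rightarrow> real \<Rightarrow> ereal" where
  "information_complexity X Y g \<epsilon> =
     (INF \<pi>\<in>{\<pi>. computes_with_error \<pi> X Y g \<epsilon>}.
        SUP \<mu>\<in>{\<mu>. set_pmf \<mu> \<subseteq> X \<times> Y}. ereal (information_cost \<mu> \<pi>))"

definition tuples :: "'a set \<Rightarrow> nat \<Rightarrow> 'a list set" where
  "tuples X n = {xs. length xs = n \<and> set xs \<subseteq> X}"

(* On bool, (\<noteq>) is exclusive or. *)
definition xor_power :: "('x \<Rightarrow> 'y \<Rightarrow> bool) \<Rightarrow> 'x list \<Rightarrow> 'y list \<Rightarrow> bool" where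
  "xor_power f xs ys = foldr (\<noteq>) (map2 f xs ys) False"

end

theory Submission
  imports Defs "HOL-Probability.Product_PMF"
begin

text \<open>Ten levels of majority-of-three voting turn a protocol with error \<open>1/n \<le> 1/3\<close> into one with
  error at most \<open>1/(10n)\<close>, since each level multiplies the error by at most \<open>7/9\<close>; running the result
  on each of the \<open>n\<close> coordinates and announcing the xor then errs with probability at most \<open>1/10\<close>.
  Announcing functions of earlier messages reveals nothing, so it remains to see that the information
  cost is subadditive. Here \<open>I(M : X | Y M0)\<close> is the minimum over families \<open>R\<close> of the expected relative
  entropy of the law of \<open>M\<close> given \<open>(X, Y)\<close> to \<open>R Y\<close>. For independent runs the product of the optimal
  families of the parts is a candidate whose relative entropy is the sum of the parts, and in
  this form no entropy of the possibly infinite transcript occurs.\<close>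

section \<open>Domination and relative entropy of discrete distributions\<close>

text \<open>Boundedness of the density of \<open>P\<close> with respect to \<open>Q\<close>. It is
  stronger than absolute continuity and makes the log-likelihood ratio integrable, so that
  expectations of it can be split and compared.\<close>

definition dominated :: "'a pmf \<Rightarrow> 'a pmf \<Rightarrow> bool" where
  "dominated P Q \<longleftrightarrow> (\<exists>K. \<forall>m. pmf P m \<le> K * pmf Q m)"

text \<open>The Kullback-Leibler divergence in bits. The expectation defaults to 0 when the
  logarithm is not integrable, so domination accompanies it wherever two different laws are
  compared.\<close>

definition relative_entropy :: "'a pmf \<Rightarrow> 'a pmf \<Rightarrow> real" where
  "relative_entropy P Q = measure_pmf.expectation P (\<lambda>m. log 2 (pmf P m / pmf Q m))"

lemma dominatedE:
  assumes "dominated P Q"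
  obtains K where "K > 0" "\<And>m. pmf P m \<le> K * pmf Q m"
proof -
  obtain K where K: "\<And>m. pmf P m \<le> K * pmf Q m"
    using assms by (auto simp: dominated_def)
  have "pmf P m \<le> max K 1 * pmf Q m" for m
    using K[of m] mult_right_mono[of K "max K 1" "pmf Q m"] by (simp add: pmf_nonneg)
  then show thesis by (intro that[of "max K 1"]) auto
qed

lemma dominated_pos: "dominated P Q \<Longrightarrow> m \<in> set_pmf P \<Longrightarrow> pmf Q m > 0"
  by (metis dominated_def mult_zero_right order_antisym pmf_nonneg pmf_positive_iff set_pmf_iff
      less_eq_real_def)

lemma dominated_refl: "dominated P P"
  unfolding dominated_def by (rule exI[of _ 1]) simp

lemma dominated_pair_pmf:
  assumes "dominated P Q" "dominated P' Q'"
  shows "dominated (pair_pmf P P') (pair_pmf Q Q')"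
proof -
  from assms(1) obtain K where K: "K > 0" "\<And>m. pmf P m \<le> K * pmf Q m" by (rule dominatedE) blast
  from assms(2) obtain K' where K': "K' > 0" "\<And>m. pmf P' m \<le> K' * pmf Q' m" by (rule dominatedE) blast
  have "pmf (pair_pmf P P') m \<le> (K * K') * pmf (pair_pmf Q Q') m" for m
    using mult_mono[OF K(2)[of "fst m"] K'(2)[of "snd m"]] K(1)
    by (cases m) (simp add: pmf_pair mult_ac)
  then show ?thesis unfolding dominated_def by blast
qed

lemma dominated_map_pmf:
  assumes "dominated P Q"
  shows "dominated (map_pmf g P) (map_pmf g Q)"
proof -
  from assms obtain K where K: "K > 0" "\<And>m. pmf P m \<le> K * pmf Q m" by (rule dominatedE) blast
  have "pmf (map_pmf g P) k \<le> K * pmf (map_pmf g Q) k" for k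
  proof -
    have "ennreal (pmf (map_pmf g P) k) = (\<integral>\<^sup>+m. pmf P m \<partial>count_space (g -` {k}))"
      by (simp add: ennreal_pmf_map nn_integral_pmf)
    also have "\<dots> \<le> (\<integral>\<^sup>+m. ennreal K * pmf Q m \<partial>count_space (g -` {k}))"
      using K by (intro nn_integral_mono) (simp flip: ennreal_mult')
    also have "\<dots> = ennreal K * (\<integral>\<^sup>+m. pmf Q m \<partial>count_space (g -` {k}))"
      by (intro nn_integral_cmult) auto
    also have "\<dots> = ennreal (K * pmf (map_pmf g Q) k)"
      using K(1) by (simp add: ennreal_pmf_map nn_integral_pmf ennreal_mult')
    finally show ?thesis using K(1) by (subst (asm) ennreal_le_iff) auto
  qed
  then show ?thesis unfolding dominated_def by blast
qed

text \<open>Change of measure. Only an inequality holds, because the mass of \<open>Q\<close>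
  outside the support of \<open>P\<close> is lost.\<close>

lemma nn_integral_likelihood_ratio:
  "(\<integral>\<^sup>+m. ennreal (pmf Q m / pmf P m) * h m \<partial>measure_pmf P) \<le> (\<integral>\<^sup>+m. h m \<partial>measure_pmf Q)"
proof -
  have *: "ennreal (pmf P m) * (ennreal (pmf Q m / pmf P m) * h m) \<le> ennreal (pmf Q m) * h m" for m
  proof (cases "pmf P m = 0")
    case False
    then have "ennreal (pmf P m) * ennreal (pmf Q m / pmf P m) = ennreal (pmf Q m)"
      by (subst ennreal_mult'[symmetric]) auto
    then show ?thesis by (simp flip: mult.assoc)
  qed simp
  show ?thesis
    unfolding nn_integral_measure_pmf by (intro nn_integral_mono *)
qed

lemma nn_integral_likelihood_ratio_le_1:
  "(\<integral>\<^sup>+m. ennreal (pmf Q m / pmf P m) \<partial>measure_pmf P) \<le> 1"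
  using nn_integral_likelihood_ratio[where P=P and Q=Q and h="\<lambda>_. 1"] by simp

lemma integrable_likelihood_ratio:
  "integrable (measure_pmf P) (\<lambda>m. pmf Q m / pmf P m)"
proof (rule integrableI_bounded)
  show "(\<integral>\<^sup>+m. ennreal (norm (pmf Q m / pmf P m)) \<partial>measure_pmf P) < \<infinity>"
    using nn_integral_likelihood_ratio_le_1[where P=P and Q=Q] by (auto simp: le_less_trans)
qed auto

lemma log2_le: "z > 0 \<Longrightarrow> log 2 z \<le> (z - 1) / ln (2::real)"
  unfolding log_def by (intro divide_right_mono ln_le_minus_one) auto

text \<open>Domination bounds the logarithm above by \<open>log 2 K\<close>. For the lower bound,
  \<open>log2_le\<close> applied to the inverse ratio gives a multiple of
  \<open>pmf Q m / pmf P m\<close>, which is integrable under \<open>P\<close>.\<close>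

lemma integrable_log_ratio:
  assumes "dominated P Q"
  shows "integrable (measure_pmf P) (\<lambda>m. log 2 (pmf P m / pmf Q m))"
proof -
  from assms obtain K where K: "K > 0" "\<And>m. pmf P m \<le> K * pmf Q m" by (rule dominatedE) blast
  have "AE m in measure_pmf P. norm (log 2 (pmf P m / pmf Q m))
          \<le> norm (\<bar>log 2 K\<bar> + (pmf Q m / pmf P m) / ln 2)"
  proof (intro AE_pmfI)
    fix m assume m: "m \<in> set_pmf P"
    have P: "pmf P m > 0" and Q: "pmf Q m > 0"
      using m dominated_pos[OF assms m] by (auto simp: pmf_positive)
    have "log 2 (pmf P m / pmf Q m) \<le> log 2 K"
      using P Q K(1) K(2)[of m] by (subst log_le_cancel_iff) (simp_all add: divide_le_eq)
    moreover have "log 2 (pmf Q m / pmf P m) \<le> (pmf Q m / pmf P m - 1) / ln 2"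
      using P Q by (intro log2_le) auto
    moreover have "(pmf Q m / pmf P m - 1) / ln 2 \<le> (pmf Q m / pmf P m) / ln 2"
      by (intro divide_right_mono) auto
    moreover have "log 2 (pmf Q m / pmf P m) = - log 2 (pmf P m / pmf Q m)"
      using P Q by (simp add: log_divide)
    moreover have "0 \<le> (pmf Q m / pmf P m) / ln 2" using P Q by simp
    ultimately show "norm (log 2 (pmf P m / pmf Q m))
          \<le> norm (\<bar>log 2 K\<bar> + (pmf Q m / pmf P m) / ln 2)"
      unfolding real_norm_def by linarith
  qed
  moreover have "integrable (measure_pmf P) (\<lambda>m. \<bar>log 2 K\<bar> + (pmf Q m / pmf P m) / ln 2)"
    by (intro Bochner_Integration.integrable_add integrable_divide integrable_likelihood_ratio
        measure_pmf.integrable_const)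
  ultimately show ?thesis
    by (rule Bochner_Integration.integrable_bound[rotated 2]) simp_all
qed

text \<open>Jensen's inequality for the logarithm, by way of its tangent at 1. It yields both the
  data processing inequality and the optimality of the observer's law.\<close>

lemma expectation_log_nonpos:
  assumes int: "integrable (measure_pmf P) (\<lambda>m. log 2 (v m))"
    and pos: "\<And>m. m \<in> set_pmf P \<Longrightarrow> v m > 0"
    and le: "(\<integral>\<^sup>+m. ennreal (v m) \<partial>measure_pmf P) \<le> 1"
  shows "measure_pmf.expectation P (\<lambda>m. log 2 (v m)) \<le> 0"
proof -
  have AE: "AE m in measure_pmf P. 0 \<le> v m"
    using pos by (auto intro!: AE_pmfI less_imp_le)
  have "(\<integral>\<^sup>+m. ennreal (norm (v m)) \<partial>measure_pmf P) = (\<integral>\<^sup>+m. ennreal (v m) \<partial>measure_pmf P)"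
    using AE by (intro nn_integral_cong_AE) auto
  then have intv: "integrable (measure_pmf P) v"
    using le by (intro integrableI_bounded) (auto simp: le_less_trans)
  have "ennreal (measure_pmf.expectation P v) \<le> 1"
    using le nn_integral_eq_integral[OF intv AE] by simp
  then have "measure_pmf.expectation P v \<le> 1"
    by simp
  moreover have "measure_pmf.expectation P (\<lambda>m. log 2 (v m))
      \<le> measure_pmf.expectation P (\<lambda>m. (v m - 1) / ln 2)"
    using intv pos by (intro integral_mono_AE int AE_pmfI log2_le) auto
  moreover have "measure_pmf.expectation P (\<lambda>m. (v m - 1) / ln 2)
      = (measure_pmf.expectation P v - 1) / ln 2"
    using intv by simp
  ultimately show ?thesis
    by (smt (verit) divide_nonpos_nonneg ln_ge_zero)
qed

text \<open>The data processing inequality.\<close>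

lemma relative_entropy_map_pmf_le:
  assumes "dominated P Q"
  shows "relative_entropy (map_pmf g P) (map_pmf g Q) \<le> relative_entropy P Q"
proof -
  let ?P = "map_pmf g P" and ?Q = "map_pmf g Q"
  \<comment> \<open>\<open>log 2 (v m)\<close> is the divergence integrand after applying
    \<open>g\<close> minus the one before. Changing the measure from \<open>P\<close> to
    \<open>Q\<close> bounds the mean of \<open>v\<close> by that of the likelihood ratio of the two
    images, which is at most 1.\<close>
  define v where "v m = (pmf ?P (g m) / pmf ?Q (g m)) * (pmf Q m / pmf P m)" for m
  have dom: "dominated ?P ?Q" by (rule dominated_map_pmf) fact
  have pos: "pmf ?P (g m) > 0" "pmf ?Q (g m) > 0" "pmf P m > 0" "pmf Q m > 0"
    if "m \<in> set_pmf P" for m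
    using that dominated_pos[OF assms that] dominated_pos[OF dom, of "g m"]
    by (auto simp: pmf_positive)
  have int1: "integrable (measure_pmf P) (\<lambda>m. log 2 (pmf ?P (g m) / pmf ?Q (g m)))"
    using integrable_log_ratio[OF dom] by (simp add: map_pmf_rep_eq integrable_distr_eq)
  note int2 = integrable_log_ratio[OF assms]
  have eq: "log 2 (v m) = log 2 (pmf ?P (g m) / pmf ?Q (g m)) - log 2 (pmf P m / pmf Q m)"
    if "m \<in> set_pmf P" for m
    using pos[OF that] by (simp add: v_def log_mult log_divide)
  have "integrable (measure_pmf P) (\<lambda>m. log 2 (v m)) \<longleftrightarrow> integrable (measure_pmf P)
      (\<lambda>m. log 2 (pmf ?P (g m) / pmf ?Q (g m)) - log 2 (pmf P m / pmf Q m))"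
    using eq by (intro integrable_cong_AE) (auto intro!: AE_pmfI)
  then have int: "integrable (measure_pmf P) (\<lambda>m. log 2 (v m))"
    using int1 int2 by simp
  have "(\<integral>\<^sup>+m. ennreal (v m) \<partial>measure_pmf P)
      = (\<integral>\<^sup>+m. ennreal (pmf Q m / pmf P m) * ennreal (pmf ?P (g m) / pmf ?Q (g m)) \<partial>measure_pmf P)"
    unfolding v_def by (subst ennreal_mult'[symmetric]) (auto simp: mult_ac)
  also have "\<dots> \<le> (\<integral>\<^sup>+m. ennreal (pmf ?P (g m) / pmf ?Q (g m)) \<partial>measure_pmf Q)"
    by (rule nn_integral_likelihood_ratio)
  also have "\<dots> = (\<integral>\<^sup>+k. ennreal (pmf ?P k / pmf ?Q k) \<partial>measure_pmf ?Q)"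
    by simp
  also have "\<dots> \<le> 1" by (rule nn_integral_likelihood_ratio_le_1)
  finally have "measure_pmf.expectation P (\<lambda>m. log 2 (v m)) \<le> 0"
    using pos by (intro expectation_log_nonpos int) (auto simp: v_def)
  moreover have "measure_pmf.expectation P (\<lambda>m. log 2 (v m)) = measure_pmf.expectation P
      (\<lambda>m. log 2 (pmf ?P (g m) / pmf ?Q (g m)) - log 2 (pmf P m / pmf Q m))"
    using eq by (intro integral_cong_AE) (auto intro!: AE_pmfI)
  ultimately show ?thesis
    unfolding relative_entropy_def using int1 int2 by simp
qed

section \<open>Products and finite mixtures\<close>

lemma integrable_pair_pmf_fst:
  fixes h :: "'a \<Rightarrow> real"
  assumes "integrable (measure_pmf P) h"
  shows "integrable (measure_pmf (pair_pmf P Q)) (\<lambda>m. h (fst m))"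
proof -
  have "integrable (measure_pmf (map_pmf fst (pair_pmf P Q))) h"
    using assms by (simp add: map_fst_pair_pmf)
  then show ?thesis by (simp add: map_pmf_rep_eq integrable_distr_eq)
qed

lemma integrable_pair_pmf_snd:
  fixes h :: "'a \<Rightarrow> real"
  assumes "integrable (measure_pmf Q) h"
  shows "integrable (measure_pmf (pair_pmf P Q)) (\<lambda>m. h (snd m))"
proof -
  have "integrable (measure_pmf (map_pmf snd (pair_pmf P Q))) h"
    using assms by (simp add: map_snd_pair_pmf)
  then show ?thesis by (simp add: map_pmf_rep_eq integrable_distr_eq)
qed

text \<open>The logarithm turns the product of likelihood ratios into a sum, and domination makes
  each summand integrable, so each can be integrated over its own marginal.\<close>

lemma relative_entropy_pair_pmf:
  assumes "dominated P Q" "dominated P' Q'"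
  shows "relative_entropy (pair_pmf P P') (pair_pmf Q Q')
    = relative_entropy P Q + relative_entropy P' Q'"
proof -
  have "relative_entropy (pair_pmf P P') (pair_pmf Q Q')
    = measure_pmf.expectation (pair_pmf P P')
       (\<lambda>m. log 2 (pmf P (fst m) / pmf Q (fst m)) + log 2 (pmf P' (snd m) / pmf Q' (snd m)))"
    unfolding relative_entropy_def
  proof (intro integral_cong_AE AE_pmfI)
    fix m assume "m \<in> set_pmf (pair_pmf P P')"
    then have "pmf P (fst m) > 0" "pmf Q (fst m) > 0" "pmf P' (snd m) > 0" "pmf Q' (snd m) > 0"
      using dominated_pos[OF assms(1), of "fst m"] dominated_pos[OF assms(2), of "snd m"]
      by (auto simp: pmf_positive)
    then show "log 2 (pmf (pair_pmf P P') m / pmf (pair_pmf Q Q') m) =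
       log 2 (pmf P (fst m) / pmf Q (fst m)) + log 2 (pmf P' (snd m) / pmf Q' (snd m))"
      by (cases m) (simp add: pmf_pair log_divide log_mult)
  qed auto
  also have "\<dots> = measure_pmf.expectation (map_pmf fst (pair_pmf P P')) (\<lambda>m. log 2 (pmf P m / pmf Q m))
     + measure_pmf.expectation (map_pmf snd (pair_pmf P P')) (\<lambda>m. log 2 (pmf P' m / pmf Q' m))"
    using assms[THEN integrable_log_ratio] unfolding integral_map_pmf
    by (intro Bochner_Integration.integral_add integrable_pair_pmf_fst integrable_pair_pmf_snd)
  finally show ?thesis
    by (simp add: relative_entropy_def map_fst_pair_pmf map_snd_pair_pmf)
qed

lemma relative_entropy_refl: "relative_entropy P P = 0"
proof -
  have "relative_entropy P P = measure_pmf.expectation P (\<lambda>m. 0)"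
    unfolding relative_entropy_def
    by (intro integral_cong_AE AE_pmfI) (auto simp: set_pmf_iff)
  then show ?thesis by simp
qed

text \<open>For nonnegative functions this is the corresponding law for \<open>nn_integral\<close>;
  the finite support of \<open>p\<close> keeps the outer integral finite. The general case follows
  by splitting \<open>h\<close> into its positive and negative parts.\<close>

lemma expectation_bind_finite:
  fixes h :: "'b \<Rightarrow> real"
  assumes fin: "finite (set_pmf p)"
    and int: "\<And>x. x \<in> set_pmf p \<Longrightarrow> integrable (measure_pmf (q x)) h"
  shows integrable_bind_finite: "integrable (measure_pmf (bind_pmf p q)) h"
    and "measure_pmf.expectation (bind_pmf p q) h
      = measure_pmf.expectation p (\<lambda>x. measure_pmf.expectation (q x) h)"
proof -
  have nonneg: "integrable (measure_pmf (bind_pmf p q)) g \<and>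
      measure_pmf.expectation (bind_pmf p q) g
      = measure_pmf.expectation p (\<lambda>x. measure_pmf.expectation (q x) g)"
    if g: "\<And>m. g m \<ge> 0" "\<And>x. x \<in> set_pmf p \<Longrightarrow> integrable (measure_pmf (q x)) g"
    for g :: "'b \<Rightarrow> real"
  proof -
    have "(\<integral>\<^sup>+m. ennreal (g m) \<partial>measure_pmf (bind_pmf p q))
        = (\<integral>\<^sup>+x. ennreal (measure_pmf.expectation (q x) g) \<partial>measure_pmf p)"
      unfolding nn_integral_bind_pmf using g
      by (intro nn_integral_cong_AE AE_pmfI nn_integral_eq_integral) auto
    also have "\<dots> = ennreal (measure_pmf.expectation p (\<lambda>x. measure_pmf.expectation (q x) g))"
      using g(1) by (intro nn_integral_eq_integral integrable_measure_pmf_finite fin)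
        (auto intro!: AE_pmfI Bochner_Integration.integral_nonneg)
    finally have eq: "(\<integral>\<^sup>+m. ennreal (g m) \<partial>measure_pmf (bind_pmf p q))
        = ennreal (measure_pmf.expectation p (\<lambda>x. measure_pmf.expectation (q x) g))" .
    moreover have "measure_pmf.expectation p (\<lambda>x. measure_pmf.expectation (q x) g) \<ge> 0"
      using g(1) by (auto intro!: Bochner_Integration.integral_nonneg)
    ultimately show ?thesis
      using g(1) by (intro conjI integrableI_bounded integral_eq_nn_integral[THEN trans]) auto
  qed
  define pos neg where "pos m = max (h m) 0" and "neg m = max (- h m) 0" for m
  have h: "h = (\<lambda>m. pos m - neg m)"
    by (auto simp: pos_def neg_def)
  have ints: "integrable (measure_pmf (q x)) pos" "integrable (measure_pmf (q x)) neg"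
    if "x \<in> set_pmf p" for x
    using int[OF that] by (auto simp: pos_def[abs_def] neg_def[abs_def])
  have pos: "integrable (measure_pmf (bind_pmf p q)) pos"
      "measure_pmf.expectation (bind_pmf p q) pos
      = measure_pmf.expectation p (\<lambda>x. measure_pmf.expectation (q x) pos)"
    using nonneg[of pos] ints by (auto simp: pos_def)
  have neg: "integrable (measure_pmf (bind_pmf p q)) neg"
      "measure_pmf.expectation (bind_pmf p q) neg
      = measure_pmf.expectation p (\<lambda>x. measure_pmf.expectation (q x) neg)"
    using nonneg[of neg] ints by (auto simp: neg_def)
  show "integrable (measure_pmf (bind_pmf p q)) h"
    unfolding h using pos(1) neg(1) by simp
  have "measure_pmf.expectation p (\<lambda>x. measure_pmf.expectation (q x) h)
      = measure_pmf.expectation p (\<lambda>x. measure_pmf.expectation (q x) pos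
          - measure_pmf.expectation (q x) neg)"
    unfolding h using ints by (intro integral_cong_AE AE_pmfI) auto
  also have "\<dots> = measure_pmf.expectation p (\<lambda>x. measure_pmf.expectation (q x) pos)
      - measure_pmf.expectation p (\<lambda>x. measure_pmf.expectation (q x) neg)"
    using fin by (intro Bochner_Integration.integral_diff integrable_measure_pmf_finite)
  finally show "measure_pmf.expectation (bind_pmf p q) h
      = measure_pmf.expectation p (\<lambda>x. measure_pmf.expectation (q x) h)"
    unfolding pos(2)[symmetric] neg(2)[symmetric] using pos(1) neg(1) by (simp add: h)
qed

section \<open>Mutual information as relative entropy\<close>

lemma pair_count_space_UNIV:
  "(count_space UNIV :: 'a::countable measure) \<Otimes>\<^sub>M (count_space UNIV :: 'b::countable measure)
    = count_space UNIV"
  by (subst pair_measure_countable) auto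

lemma pair_measure_measure_pmf:
  fixes P :: "'a::countable pmf" and Q :: "'b::countable pmf"
  shows "measure_pmf P \<Otimes>\<^sub>M measure_pmf Q = measure_pmf (pair_pmf P Q)"
proof (rule measure_eqI_countable[where A=UNIV])
  have "sets (measure_pmf P \<Otimes>\<^sub>M measure_pmf Q)
      = sets ((count_space UNIV :: 'a measure) \<Otimes>\<^sub>M (count_space UNIV :: 'b measure))"
    by (intro sets_pair_measure_cong) auto
  then show "sets (measure_pmf P \<Otimes>\<^sub>M measure_pmf Q) = Pow UNIV"
    unfolding pair_count_space_UNIV by simp
  show "emeasure (measure_pmf P \<Otimes>\<^sub>M measure_pmf Q) {a} = emeasure (measure_pmf (pair_pmf P Q)) {a}" for a
  proof (cases a)
    case (Pair x y)
    have "emeasure (measure_pmf P \<Otimes>\<^sub>M measure_pmf Q) ({x} \<times> {y})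
        = emeasure (measure_pmf P) {x} * emeasure (measure_pmf Q) {y}"
      by (rule measure_pmf.emeasure_pair_measure_Times) simp_all
    also have "\<dots> = ennreal (pmf P x * pmf Q y)"
      by (simp add: emeasure_pmf_single ennreal_mult')
    also have "\<dots> = emeasure (measure_pmf (pair_pmf P Q)) {(x, y)}"
      by (simp only: emeasure_pmf_single pmf_pair)
    also have "{x} \<times> {y} = {(x, y)}" by simp
    finally show ?thesis unfolding Pair .
  qed
qed simp_all

text \<open>Mutual information is the divergence of the joint law from the product of its marginals.
  Both have densities with respect to the counting measure, and domination supplies the absolute
  continuity needed to compute with them.\<close>

lemma mutual_information_measure_pmf:
  fixes A :: "'s \<Rightarrow> 'a::countable" and B :: "'s \<Rightarrow> 'b::countable"
  assumes "dominated (map_pmf (\<lambda>w. (A w, B w)) p) (pair_pmf (map_pmf A p) (map_pmf B p))"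
  shows "prob_space.mutual_information (measure_pmf p) 2 (count_space UNIV) (count_space UNIV) A B
    = relative_entropy (map_pmf (\<lambda>w. (A w, B w)) p) (pair_pmf (map_pmf A p) (map_pmf B p))"
proof -
  let ?P = "map_pmf (\<lambda>w. (A w, B w)) p" and ?Q = "pair_pmf (map_pmf A p) (map_pmf B p)"
  interpret C: sigma_finite_measure "count_space (UNIV :: ('a \<times> 'b) set)"
    by (rule sigma_finite_measure_count_space)
  have "prob_space.mutual_information (measure_pmf p) 2 (count_space UNIV) (count_space UNIV) A B
      = KL_divergence 2 (measure_pmf ?Q) (measure_pmf ?P)"
    unfolding prob_space.mutual_information_def[OF measure_pmf.prob_space_axioms]
      pair_measure_measure_pmf[symmetric] pair_count_space_UNIV map_pmf_rep_eq ..
  also have "\<dots> = KL_divergence 2 (density (count_space UNIV) (pmf ?Q)) (density (count_space UNIV) (pmf ?P))"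
    unfolding measure_pmf_eq_density ..
  also have "\<dots> = (\<integral>x. pmf ?P x * log 2 (pmf ?P x / pmf ?Q x) \<partial>count_space UNIV)"
  proof (rule C.KL_density_density)
    show "AE x in count_space UNIV. pmf ?Q x = 0 \<longrightarrow> pmf ?P x = 0"
    proof (intro AE_I2 impI)
      fix x assume "pmf ?Q x = 0"
      then have "x \<notin> set_pmf ?P"
        using dominated_pos[OF assms, of x] by (metis less_irrefl)
      then show "pmf ?P x = 0" unfolding set_pmf_iff by simp
    qed
  qed simp_all
  also have "\<dots> = relative_entropy ?P ?Q"
    unfolding relative_entropy_def measure_pmf_eq_density
    by (subst integral_density) simp_all
  finally show ?thesis .
qed

text \<open>The probability of \<open>(a, b)\<close> is at most that of \<open>b\<close>, which is
  \<open>1 / pmf ?A a\<close> times the product of the marginal probabilities. Summing these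
  reciprocals over the finite range of \<open>A\<close> gives a constant that serves for every
  \<open>a\<close>.\<close>

lemma dominated_pair_of_finite:
  assumes "finite (A ` set_pmf p)"
  shows "dominated (map_pmf (\<lambda>w. (A w, B w)) p) (pair_pmf (map_pmf A p) (map_pmf B p))"
proof -
  let ?P = "map_pmf (\<lambda>w. (A w, B w)) p" and ?A = "map_pmf A p" and ?B = "map_pmf B p"
  define K where "K = (\<Sum>a\<in>set_pmf ?A. 1 / pmf ?A a)"
  have fin: "finite (set_pmf ?A)" using assms by simp
  have "pmf ?P (a, b) \<le> K * pmf (pair_pmf ?A ?B) (a, b)" for a b
  proof (cases "a \<in> set_pmf ?A")
    case True
    have "pmf ?P (a, b) \<le> pmf ?B b"
      unfolding pmf_map by (intro measure_pmf.finite_measure_mono) auto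
    also have "\<dots> = 1 / pmf ?A a * (pmf ?A a * pmf ?B b)"
      using True pmf_positive[of a ?A] by simp
    also have "\<dots> \<le> K * (pmf ?A a * pmf ?B b)"
      unfolding K_def using True fin
      by (intro mult_right_mono member_le_sum) auto
    finally show ?thesis by (simp add: pmf_pair)
  next
    case False
    then have "(a, b) \<notin> set_pmf ?P" by auto
    then have "pmf ?P (a, b) = 0" unfolding set_pmf_iff by simp
    moreover have "pmf ?A a = 0" using False unfolding set_pmf_iff by simp
    ultimately show ?thesis by (simp add: pmf_pair)
  qed
  then show ?thesis unfolding dominated_def by auto
qed

lemma cond_mutual_info_eq:
  fixes A :: "'s \<Rightarrow> 'a::countable" and B :: "'s \<Rightarrow> 'b::countable" and C :: "'s \<Rightarrow> 'c::countable"
  assumes fin: "finite (A ` set_pmf p)"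
  shows "cond_mutual_info p A B C =
    relative_entropy (map_pmf (\<lambda>w. (A w, B w, C w)) p)
      (pair_pmf (map_pmf A p) (map_pmf (\<lambda>w. (B w, C w)) p)) -
    relative_entropy (map_pmf (\<lambda>w. (A w, C w)) p) (pair_pmf (map_pmf A p) (map_pmf C p))"
  unfolding cond_mutual_info_def pair_count_space_UNIV
    prob_space.conditional_mutual_information_def[OF measure_pmf.prob_space_axioms]
  by (intro arg_cong2[of _ _ _ _ "(-)"] mutual_information_measure_pmf dominated_pair_of_finite fin)

section \<open>Messages sent on random inputs and what an observer learns from them\<close>

definition joint :: "'s pmf \<Rightarrow> ('s \<Rightarrow> 'm pmf) \<Rightarrow> ('s \<times> 'm) pmf" where
  "joint p w = bind_pmf p (\<lambda>s. map_pmf (Pair s) (w s))"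

lemma pmf_joint: "pmf (joint p w) (s, m) = pmf p s * pmf (w s) m"
proof -
  have "pmf (joint p w) (s, m)
      = measure_pmf.expectation p (\<lambda>s'. pmf (map_pmf (Pair s') (w s')) (s, m))"
    by (simp add: joint_def pmf_bind)
  also have "\<dots> = (\<Sum>s'\<in>{s}. pmf (map_pmf (Pair s') (w s')) (s, m) * pmf p s')"
  proof (rule integral_measure_pmf_real)
    fix s' assume "pmf (map_pmf (Pair s') (w s')) (s, m) \<noteq> 0"
    then have "(s, m) \<in> set_pmf (map_pmf (Pair s') (w s'))" unfolding set_pmf_iff .
    then show "s' \<in> {s}" by auto
  qed simp
  also have "\<dots> = pmf p s * pmf (w s) m"
    by (simp add: pmf_map_inj' inj_on_def)
  finally show ?thesis .
qed

lemma set_pmf_joint: "set_pmf (joint p w) = (SIGMA s:set_pmf p. set_pmf (w s))"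
  by (auto simp: joint_def)

lemma map_fst_joint: "map_pmf fst (joint p w) = p"
  by (simp add: joint_def map_bind_pmf map_pmf_comp map_pmf_const bind_return_pmf')

lemma expectation_joint_finite:
  fixes h :: "'s \<times> 'm \<Rightarrow> real"
  assumes fin: "finite (set_pmf p)"
    and int: "\<And>s. s \<in> set_pmf p \<Longrightarrow> integrable (measure_pmf (w s)) (\<lambda>m. h (s, m))"
  shows integrable_joint_finite: "integrable (measure_pmf (joint p w)) h"
    and "measure_pmf.expectation (joint p w) h
      = measure_pmf.expectation p (\<lambda>s. measure_pmf.expectation (w s) (\<lambda>m. h (s, m)))"
proof -
  have int': "integrable (measure_pmf (map_pmf (Pair s) (w s))) h" if "s \<in> set_pmf p" for s
    using int[OF that] by (simp add: map_pmf_rep_eq integrable_distr_eq)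
  show "integrable (measure_pmf (joint p w)) h"
    unfolding joint_def by (rule integrable_bind_finite[OF fin int'])
  show "measure_pmf.expectation (joint p w) h
      = measure_pmf.expectation p (\<lambda>s. measure_pmf.expectation (w s) (\<lambda>m. h (s, m)))"
    unfolding joint_def by (subst expectation_bind_finite(2)[OF fin int']) simp_all
qed

text \<open>The law of the message given that the observer, who sees \<open>g s\<close>, has seen \<open>c\<close>.\<close>

definition observer :: "'s pmf \<Rightarrow> ('s \<Rightarrow> 'm pmf) \<Rightarrow> ('s \<Rightarrow> 'c) \<Rightarrow> 'c \<Rightarrow> 'm pmf" where
  "observer p w g c =
     map_pmf snd (cond_pmf (map_pmf (\<lambda>(s, m). (g s, m)) (joint p w)) ({c} \<times> UNIV))"

text \<open>The conditional mutual information of the input and the message given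
  \<open>g s\<close>, as the mean divergence of the true law of the message from the law that the
  observer expects.\<close>

definition information_gain :: "'s pmf \<Rightarrow> ('s \<Rightarrow> 'm pmf) \<Rightarrow> ('s \<Rightarrow> 'c) \<Rightarrow> real" where
  "information_gain p w g =
     measure_pmf.expectation p (\<lambda>s. relative_entropy (w s) (observer p w g (g s)))"

text \<open>Disintegration of the law of \<open>(g s, m)\<close>. The hypothesis ensures that the
  event conditioned on has positive probability, without which \<open>cond_pmf\<close> is
  unspecified.\<close>

lemma pmf_observer:
  fixes w :: "'s \<Rightarrow> 'm pmf"
  assumes "c \<in> g ` set_pmf p"
  shows "pmf (map_pmf (\<lambda>(s, m). (g s, m)) (joint p w)) (c, m)
    = pmf (map_pmf g p) c * pmf (observer p w g c) m"
proof -
  let ?D = "map_pmf (\<lambda>(s, m). (g s, m)) (joint p w)" and ?S = "{c} \<times> (UNIV :: 'm set)"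
  obtain s m' where sm: "s \<in> set_pmf p" "c = g s" "m' \<in> set_pmf (w s)"
    using assms set_pmf_not_empty by fastforce
  have ne: "set_pmf ?D \<inter> ?S \<noteq> {}"
  proof -
    have "(g s, m') \<in> set_pmf ?D" using sm by (force simp: set_pmf_joint)
    then show ?thesis using sm by blast
  qed
  have "map_pmf fst ?D = map_pmf g (map_pmf fst (joint p w))"
    by (simp add: map_pmf_comp case_prod_unfold)
  then have fstD: "map_pmf fst ?D = map_pmf g p"
    by (simp add: map_fst_joint)
  have "fst -` {c} = ?S" by auto
  then have S: "measure_pmf.prob ?D ?S = pmf (map_pmf g p) c"
    unfolding fstD[symmetric] pmf_map[of fst] by simp
  have "c \<in> set_pmf (map_pmf g p)" using assms by simp
  then have pos: "pmf (map_pmf g p) c > 0" by (rule pmf_positive)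
  have "pmf (observer p w g c) m = measure_pmf.prob (cond_pmf ?D ?S) (snd -` {m})"
    by (simp add: observer_def pmf_map)
  \<comment> \<open>The conditioned law lives on pairs with first component \<open>c\<close>, so
    fixing the message leaves a single point.\<close>
  also have "\<dots> = measure_pmf.prob (cond_pmf ?D ?S) {(c, m)}"
    using set_cond_pmf[OF ne] by (intro measure_pmf.finite_measure_eq_AE AE_pmfI) auto
  also have "\<dots> = pmf (cond_pmf ?D ?S) (c, m)" by (simp add: measure_pmf_single)
  also have "\<dots> = pmf ?D (c, m) / pmf (map_pmf g p) c"
    unfolding pmf_cond[OF ne] S by simp
  finally show ?thesis using pos by simp
qed

text \<open>The observer's law is a mixture in which \<open>w s\<close> has weight
  \<open>pmf p s / pmf (map_pmf g p) (g s)\<close>; the constant is the inverse of this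
  weight.\<close>

lemma dominated_observer:
  assumes s: "s \<in> set_pmf p"
  shows "dominated (w s) (observer p w g (g s))"
proof -
  let ?D = "map_pmf (\<lambda>(s, m). (g s, m)) (joint p w)"
  have "pmf (w s) m \<le> pmf (map_pmf g p) (g s) / pmf p s * pmf (observer p w g (g s)) m" for m
  proof -
    have "pmf p s * pmf (w s) m = measure_pmf.prob (joint p w) {(s, m)}"
      by (simp add: measure_pmf_single pmf_joint)
    also have "\<dots> \<le> pmf ?D (g s, m)"
      unfolding pmf_map by (intro measure_pmf.finite_measure_mono) auto
    also have "\<dots> = pmf (map_pmf g p) (g s) * pmf (observer p w g (g s)) m"
      using s by (intro pmf_observer) auto
    finally show ?thesis
      using pmf_positive[OF s] by (simp add: field_simps)
  qed
  then show ?thesis unfolding dominated_def by blast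
qed

text \<open>The information gain is the least expected relative entropy to a law that is available
  to the observer.  Hence any guess of such a law yields an upper bound.\<close>

lemma information_gain_le:
  assumes fin: "finite (set_pmf p)"
    and dom: "\<And>s. s \<in> set_pmf p \<Longrightarrow> dominated (w s) (Q (g s))"
  shows "information_gain p w g \<le> measure_pmf.expectation p (\<lambda>s. relative_entropy (w s) (Q (g s)))"
proof -
  let ?J = "joint p w" and ?D = "map_pmf (\<lambda>(s, m). (g s, m)) (joint p w)"
  let ?R = "observer p w g" and ?E = "joint (map_pmf g p) Q"
  \<comment> \<open>On the support, \<open>log 2 (v z)\<close> is the difference of the two
    integrands. Multiplying both parts of the fraction by the probability of \<open>g s\<close>
    turns \<open>v\<close> into the likelihood ratio of \<open>?E\<close> to \<open>?D\<close>, two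
    laws of pairs, so its mean is at most 1.\<close>
  define v where "v = (\<lambda>(s, m). pmf (Q (g s)) m / pmf (?R (g s)) m)"
  define hR hQ where "hR = (\<lambda>(s, m). log 2 (pmf (w s) m / pmf (?R (g s)) m))"
    and "hQ = (\<lambda>(s, m). log 2 (pmf (w s) m / pmf (Q (g s)) m))"
  have intR: "integrable (measure_pmf (w s)) (\<lambda>m. hR (s, m))"
    and intQ: "integrable (measure_pmf (w s)) (\<lambda>m. hQ (s, m))" if "s \<in> set_pmf p" for s
    using integrable_log_ratio[OF dominated_observer[OF that]] integrable_log_ratio[OF dom[OF that]]
    by (simp_all add: hR_def hQ_def)
  have R: "information_gain p w g = measure_pmf.expectation ?J hR" "integrable (measure_pmf ?J) hR"
    using expectation_joint_finite[OF fin intR]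
    by (simp_all add: information_gain_def relative_entropy_def hR_def)
  have Q: "measure_pmf.expectation p (\<lambda>s. relative_entropy (w s) (Q (g s)))
      = measure_pmf.expectation ?J hQ" "integrable (measure_pmf ?J) hQ"
    using expectation_joint_finite[OF fin intQ] by (simp_all add: relative_entropy_def hQ_def)
  have pos: "pmf (Q (g s)) m > 0" "pmf (?R (g s)) m > 0" "pmf (w s) m > 0"
    if "(s, m) \<in> set_pmf ?J" for s m
    using that dominated_pos[OF dom, of s m] dominated_pos[OF dominated_observer, of s p m w g]
    by (auto simp: set_pmf_joint pmf_positive)
  have eq: "log 2 (v z) = hR z - hQ z" if "z \<in> set_pmf ?J" for z
  proof (cases z)
    case (Pair s m)
    then show ?thesis
      using pos[of s m] that by (simp add: v_def hR_def hQ_def log_divide)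
  qed
  have "integrable (measure_pmf ?J) (\<lambda>z. log 2 (v z))
      \<longleftrightarrow> integrable (measure_pmf ?J) (\<lambda>z. hR z - hQ z)"
    using eq by (intro integrable_cong_AE AE_pmfI) simp_all
  then have int: "integrable (measure_pmf ?J) (\<lambda>z. log 2 (v z))"
    using R(2) Q(2) by simp
  have "(\<integral>\<^sup>+z. ennreal (v z) \<partial>measure_pmf ?J)
      = (\<integral>\<^sup>+z. ennreal (pmf ?E (g (fst z), snd z) / pmf ?D (g (fst z), snd z)) \<partial>measure_pmf ?J)"
  proof (intro nn_integral_cong_AE AE_pmfI)
    fix z assume "z \<in> set_pmf ?J"
    then obtain s m where z: "z = (s, m)" "s \<in> set_pmf p" by (auto simp: set_pmf_joint)
    then have "g s \<in> set_pmf (map_pmf g p)" by simp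
    then have "pmf (map_pmf g p) (g s) > 0" by (rule pmf_positive)
    moreover have "pmf ?D (g s, m) = pmf (map_pmf g p) (g s) * pmf (?R (g s)) m"
      using z by (intro pmf_observer) auto
    ultimately show "ennreal (v z) = ennreal (pmf ?E (g (fst z), snd z) / pmf ?D (g (fst z), snd z))"
      unfolding z v_def by (simp add: pmf_joint)
  qed
  also have "\<dots> = (\<integral>\<^sup>+z. ennreal (pmf ?E z / pmf ?D z) \<partial>measure_pmf ?D)"
    by (simp add: case_prod_unfold)
  also have "\<dots> \<le> 1" by (rule nn_integral_likelihood_ratio_le_1)
  finally have "measure_pmf.expectation ?J (\<lambda>z. log 2 (v z)) \<le> 0"
    using pos by (intro expectation_log_nonpos int) (auto simp: v_def)
  moreover have "measure_pmf.expectation ?J (\<lambda>z. log 2 (v z))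
      = measure_pmf.expectation ?J (\<lambda>z. hR z - hQ z)"
    using eq by (intro integral_cong_AE AE_pmfI) simp_all
  ultimately show ?thesis
    unfolding R(1) Q(1) using R(2) Q(2) by simp
qed

text \<open>The guess is the image under \<open>G\<close> of the product of the two observers' laws.
  Data processing removes \<open>G\<close>, and additivity over products separates the two
  runs.\<close>

lemma information_gain_pair_le:
  assumes fin: "finite (set_pmf p)"
  shows "information_gain p (\<lambda>s. map_pmf G (pair_pmf (w s) (w' s))) g
    \<le> information_gain p w g + information_gain p w' g"
proof -
  let ?R = "\<lambda>s. observer p w g (g s)" and ?R' = "\<lambda>s. observer p w' g (g s)"
  let ?Q = "\<lambda>c. map_pmf G (pair_pmf (observer p w g c) (observer p w' g c))"
  note fin_int = integrable_measure_pmf_finite[OF fin]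
  have dom: "dominated (w s) (?R s)" "dominated (w' s) (?R' s)" if "s \<in> set_pmf p" for s
    using that by (auto intro: dominated_observer)
  have "information_gain p (\<lambda>s. map_pmf G (pair_pmf (w s) (w' s))) g
      \<le> measure_pmf.expectation p (\<lambda>s. relative_entropy (map_pmf G (pair_pmf (w s) (w' s))) (?Q (g s)))"
    by (rule information_gain_le[OF fin]) (intro dominated_map_pmf dominated_pair_pmf dom)
  also have "\<dots> \<le> measure_pmf.expectation p
      (\<lambda>s. relative_entropy (w s) (?R s) + relative_entropy (w' s) (?R' s))"
  proof (intro integral_mono_AE fin_int AE_pmfI)
    fix s assume s: "s \<in> set_pmf p"
    show "relative_entropy (map_pmf G (pair_pmf (w s) (w' s))) (?Q (g s))
        \<le> relative_entropy (w s) (?R s) + relative_entropy (w' s) (?R' s)"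
      using relative_entropy_map_pmf_le[OF dominated_pair_pmf[OF dom[OF s]], of G]
      by (simp add: relative_entropy_pair_pmf[OF dom[OF s]])
  qed
  also have "\<dots> = information_gain p w g + information_gain p w' g"
    unfolding information_gain_def by (intro Bochner_Integration.integral_add fin_int)
  finally show ?thesis .
qed

text \<open>An observer of \<open>g s\<close> can compute \<open>h (g s)\<close>, which is what the
  observer of \<open>f s\<close> sees, and can therefore use the latter's law as a guess. Extra
  knowledge about parts of \<open>s\<close> that do not affect the message does no harm.\<close>

lemma information_gain_pullback_le:
  assumes fin: "finite (set_pmf p)"
    and g: "\<And>s. s \<in> set_pmf p \<Longrightarrow> g' (f s) = h (g s)"
  shows "information_gain p (\<lambda>s. w (f s)) g \<le> information_gain (map_pmf f p) w g'"
proof -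
  have "information_gain p (\<lambda>s. w (f s)) g \<le> measure_pmf.expectation p
      (\<lambda>s. relative_entropy (w (f s)) (observer (map_pmf f p) w g' (h (g s))))"
  proof (rule information_gain_le[OF fin])
    fix s assume s: "s \<in> set_pmf p"
    then show "dominated (w (f s)) (observer (map_pmf f p) w g' (h (g s)))"
      using dominated_observer[of "f s" "map_pmf f p" w g'] g[OF s] by simp
  qed
  also have "\<dots> = information_gain (map_pmf f p) w g'"
    unfolding information_gain_def integral_map_pmf
    using g by (intro integral_cong_AE AE_pmfI) simp_all
  finally show ?thesis .
qed

lemma information_gain_const_le:
  assumes "finite (set_pmf p)"
  shows "information_gain p (\<lambda>s. q) g \<le> 0"
  using information_gain_le[OF assms, of "\<lambda>s. q" "\<lambda>c. q" g]
  by (simp add: dominated_refl relative_entropy_refl)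

text \<open>Since the public coins are independent of the inputs, seeing them alone tells the observer
  nothing, and the second half of the library's conditional mutual information only removes the
  information that the observer already had about \<open>a s\<close>.\<close>

lemma cond_mutual_info_eq_information_gain:
  fixes a :: "'s \<Rightarrow> 'a::countable" and g :: "'s \<Rightarrow> 'c::countable"
    and w :: "'s \<Rightarrow> ('k::countable \<times> 'm::countable) pmf"
  assumes fin: "finite (set_pmf p)"
    and inj: "inj_on (\<lambda>s. (a s, g s)) (set_pmf p)"
    and coin: "\<And>s. s \<in> set_pmf p \<Longrightarrow> map_pmf fst (w s) = coin"
    and law: "map_pmf (\<lambda>e. (A e, B e, C e)) E
      = map_pmf (\<lambda>(s, m). (a s, m, (g s, fst m))) (joint p w)"
  shows "cond_mutual_info E A B C = information_gain p w g"
proof -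
  let ?J = "joint p w" and ?R = "observer p w g"
  define A' where "A' = (\<lambda>z::'s \<times> 'k \<times> 'm. a (fst z))"
  define B' where "B' = (\<lambda>z::'s \<times> 'k \<times> 'm. snd z)"
  define C' where "C' = (\<lambda>z::'s \<times> 'k \<times> 'm. (g (fst z), fst (snd z)))"
  have law': "map_pmf (\<lambda>e. (A e, B e, C e)) E = map_pmf (\<lambda>z. (A' z, B' z, C' z)) ?J"
    unfolding law by (simp add: A'_def B'_def C'_def case_prod_unfold)
  have maps: "map_pmf A E = map_pmf A' ?J"
      "map_pmf (\<lambda>e. (B e, C e)) E = map_pmf (\<lambda>z. (B' z, C' z)) ?J"
      "map_pmf (\<lambda>e. (A e, C e)) E = map_pmf (\<lambda>z. (A' z, C' z)) ?J"
      "map_pmf C E = map_pmf C' ?J"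
    using arg_cong[OF law', of "map_pmf fst"] arg_cong[OF law', of "map_pmf snd"]
      arg_cong[OF law', of "map_pmf (\<lambda>(x, y, z). (x, z))"]
      arg_cong[OF law', of "map_pmf (\<lambda>(x, y, z). z)"]
    by (simp_all add: map_pmf_comp)
  have "A ` set_pmf E = A' ` set_pmf ?J"
    using arg_cong[OF maps(1), of set_pmf] by simp
  moreover have "A' ` set_pmf ?J \<subseteq> a ` set_pmf p"
    by (auto simp: A'_def set_pmf_joint)
  ultimately have finA: "finite (A ` set_pmf E)" "finite (A' ` set_pmf ?J)"
    using finite_subset[OF _ finite_imageI[OF fin]] by auto
  have indep: "map_pmf (\<lambda>(s, m). (s, fst m)) ?J = pair_pmf p coin"
  proof -
    have "map_pmf (\<lambda>(s, m). (s, fst m)) ?J = bind_pmf p (\<lambda>s. map_pmf (Pair s) (map_pmf fst (w s)))"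
      by (simp add: joint_def map_bind_pmf map_pmf_comp)
    also have "\<dots> = bind_pmf p (\<lambda>s. map_pmf (Pair s) coin)"
      using coin by (intro bind_pmf_cong) auto
    finally show ?thesis by (simp add: pair_pmf_def map_pmf_def)
  qed
  let ?ABC = "map_pmf (\<lambda>z. (A' z, B' z, C' z)) ?J" and ?AC = "map_pmf (\<lambda>z. (A' z, C' z)) ?J"
  let ?A = "map_pmf A' ?J" and ?BC = "map_pmf (\<lambda>z. (B' z, C' z)) ?J" and ?C = "map_pmf C' ?J"
  define h1 where "h1 z = log 2 (pmf ?ABC (A' z, B' z, C' z) / (pmf ?A (A' z) * pmf ?BC (B' z, C' z)))" for z
  define h2 where "h2 z = log 2 (pmf ?AC (A' z, C' z) / (pmf ?A (A' z) * pmf ?C (C' z)))" for z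
  define h where "h = (\<lambda>(s, m). log 2 (pmf (w s) m / pmf (?R (g s)) m))"
  have e1: "relative_entropy ?ABC (pair_pmf ?A ?BC) = measure_pmf.expectation ?J h1"
    unfolding relative_entropy_def integral_map_pmf h1_def by (simp only: pmf_pair)
  have e2: "relative_entropy ?AC (pair_pmf ?A ?C) = measure_pmf.expectation ?J h2"
    unfolding relative_entropy_def integral_map_pmf h2_def by (simp only: pmf_pair)
  have i1: "integrable (measure_pmf ?J) h1"
    using integrable_log_ratio[OF dominated_pair_of_finite[OF finA(2), of "\<lambda>z. (B' z, C' z)"]]
    by (simp add: map_pmf_rep_eq integrable_distr_eq pmf_pair h1_def[abs_def])
  have i2: "integrable (measure_pmf ?J) h2"
    using integrable_log_ratio[OF dominated_pair_of_finite[OF finA(2), of C']]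
    by (simp add: map_pmf_rep_eq integrable_distr_eq pmf_pair h2_def[abs_def])
  \<comment> \<open>In the difference of logarithms the probabilities of \<open>s\<close>, of
    \<open>a s\<close>, of \<open>g s\<close> and of the public coins cancel, leaving the ratio of
    \<open>w s\<close> to the observer's law.\<close>
  have eq: "h1 z - h2 z = h z" if z: "z \<in> set_pmf ?J" for z
  proof -
    obtain s m where sm: "z = (s, m)" "s \<in> set_pmf p" "m \<in> set_pmf (w s)"
      using z by (auto simp: set_pmf_joint)
    \<comment> \<open>By \<open>inj\<close> the first and third components determine
      \<open>s\<close>, and the second is \<open>m\<close>, so the triple has the probability of the
      point \<open>(s, m)\<close>.\<close>
    have "inj_on (\<lambda>z. (A' z, B' z, C' z)) (set_pmf ?J)"
      using inj by (auto simp: inj_on_def A'_def B'_def C'_def set_pmf_joint)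
    from pmf_map_inj[OF this z] have ABC: "pmf ?ABC (A' z, B' z, C' z) = pmf p s * pmf (w s) m"
      by (simp add: sm pmf_joint)
    let ?D = "map_pmf (\<lambda>(s, m). (g s, m)) ?J"
    have BC_eq: "?BC = map_pmf (\<lambda>(c, m). (m, c, fst m)) ?D"
      by (simp add: map_pmf_comp B'_def C'_def case_prod_unfold)
    \<comment> \<open>The component \<open>fst m\<close> repeats part of \<open>m\<close>, so
      appending it is injective and preserves point masses.\<close>
    have "pmf (map_pmf (\<lambda>(c, m). (m, c, fst m)) ?D) ((\<lambda>(c, m). (m, c, fst m)) (g s, m))
        = pmf ?D (g s, m)"
      by (intro pmf_map_inj') (auto simp: inj_on_def)
    also have "\<dots> = pmf (map_pmf g p) (g s) * pmf (?R (g s)) m"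
      using sm by (intro pmf_observer) auto
    finally have BC: "pmf ?BC (B' z, C' z) = pmf (map_pmf g p) (g s) * pmf (?R (g s)) m"
      unfolding BC_eq by (simp add: sm B'_def C'_def)
    have fst_m: "fst m \<in> set_pmf coin"
      using coin[OF sm(2)] sm(3) by (metis image_eqI set_map_pmf)
    have "?AC = map_pmf (\<lambda>(s, k). (a s, g s, k)) (map_pmf (\<lambda>(s, m). (s, fst m)) ?J)"
      by (simp add: map_pmf_comp A'_def C'_def case_prod_unfold)
    then have AC_eq: "?AC = map_pmf (\<lambda>(s, k). (a s, g s, k)) (pair_pmf p coin)"
      by (simp add: indep)
    have "pmf ?AC ((\<lambda>(s, k). (a s, g s, k)) (s, fst m)) = pmf (pair_pmf p coin) (s, fst m)"
      unfolding AC_eq using inj fst_m sm by (intro pmf_map_inj) (auto simp: inj_on_def)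
    then have AC: "pmf ?AC (A' z, C' z) = pmf p s * pmf coin (fst m)"
      by (simp add: sm A'_def C'_def pmf_pair)
    have "?C = map_pmf (\<lambda>(s, k). (g s, k)) (map_pmf (\<lambda>(s, m). (s, fst m)) ?J)"
      by (simp add: map_pmf_comp C'_def case_prod_unfold)
    also have "\<dots> = pair_pmf (map_pmf g p) coin"
      unfolding indep by (simp add: pair_map_pmf1 apfst_def map_prod_def)
    finally have C: "pmf ?C (C' z) = pmf (map_pmf g p) (g s) * pmf coin (fst m)"
      by (simp add: sm C'_def pmf_pair)
    have "A' z \<in> set_pmf ?A" "g s \<in> set_pmf (map_pmf g p)" using z sm by auto
    then have "pmf ?A (A' z) > 0" "pmf (map_pmf g p) (g s) > 0" by (auto intro: pmf_positive)
    moreover have "pmf p s > 0" "pmf (w s) m > 0" "pmf coin (fst m) > 0" "pmf (?R (g s)) m > 0"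
      using sm fst_m dominated_pos[OF dominated_observer[where w = w and g = g, OF sm(2)] sm(3)] by (auto intro: pmf_positive)
    ultimately show ?thesis
      unfolding h1_def h2_def h_def ABC BC AC C by (simp add: sm log_divide log_mult)
  qed
  have "cond_mutual_info E A B C
      = measure_pmf.expectation ?J h1 - measure_pmf.expectation ?J h2"
    unfolding cond_mutual_info_eq[OF finA(1)] law' maps e1 e2 ..
  also have "\<dots> = measure_pmf.expectation ?J (\<lambda>z. h1 z - h2 z)"
    using i1 i2 by simp
  also have "\<dots> = measure_pmf.expectation ?J h"
    using eq by (intro integral_cong_AE AE_pmfI) simp_all
  also have "\<dots> = information_gain p w g"
    unfolding information_gain_def relative_entropy_def
    by (subst expectation_joint_finite(2)[OF fin])
      (simp_all add: h_def integrable_log_ratio dominated_observer)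
  finally show ?thesis .
qed

section \<open>Protocols as message kernels, and their information cost\<close>

abbreviation kernel :: "('x, 'y) protocol \<Rightarrow> 'x \<times> 'y \<Rightarrow> (nat \<times> nat list) pmf" where
  "kernel \<pi> \<equiv> \<lambda>(x, y). transcript \<pi> x y"

definition run :: "('x, 'y) protocol \<Rightarrow> 'x \<Rightarrow> 'y \<Rightarrow> nat \<times> nat \<times> nat \<Rightarrow> nat \<times> nat list" where
  "run \<pi> x y = (\<lambda>(m0, ra, rb). (m0, messages \<pi> x y m0 ra rb (rounds \<pi>)))"

lemma transcript_eq_run:
  "transcript \<pi> x y = map_pmf (run \<pi> x y)
     (pair_pmf (public_coins \<pi>) (pair_pmf (alice_coins \<pi>) (bob_coins \<pi>)))"
  by (simp add: transcript_def run_def pair_pmf_def map_bind_pmf bind_assoc_pmf bind_return_pmf)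

lemma map_fst_transcript: "map_pmf fst (transcript \<pi> x y) = public_coins \<pi>"
proof -
  have "fst \<circ> run \<pi> x y = fst" by (auto simp: run_def)
  then show ?thesis
    by (simp add: transcript_eq_run pmf.map_comp map_fst_pair_pmf)
qed

lemma execution_eq_joint:
  "execution \<mu> \<pi> = map_pmf (\<lambda>((x, y), (m0, ms)). (x, y, m0, ms)) (joint \<mu> (kernel \<pi>))"
  by (simp add: execution_def joint_def map_bind_pmf map_pmf_comp case_prod_unfold map_pmf_def
      bind_assoc_pmf bind_return_pmf)

text \<open>The first summand is what Bob learns, so its observer sees \<open>snd\<close>; for Alice
  it is \<open>fst\<close>. The public coins remain part of the message, and their law does not
  depend on the inputs.\<close>

lemma information_cost_eq:
  fixes \<mu> :: "('x::countable \<times> 'y::countable) pmf"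
  assumes fin: "finite (set_pmf \<mu>)"
  shows "information_cost \<mu> \<pi>
    = information_gain \<mu> (kernel \<pi>) snd + information_gain \<mu> (kernel \<pi>) fst"
proof -
  have "cond_mutual_info (execution \<mu> \<pi>)
       (\<lambda>(x, y, m0, ms). x) (\<lambda>(x, y, m0, ms). (m0, ms)) (\<lambda>(x, y, m0, ms). (y, m0))
     = information_gain \<mu> (kernel \<pi>) snd"
    by (rule cond_mutual_info_eq_information_gain[where a = fst and coin = "public_coins \<pi>", OF fin])
      (auto simp: inj_on_def map_fst_transcript execution_eq_joint map_pmf_comp case_prod_unfold)
  moreover have "cond_mutual_info (execution \<mu> \<pi>)
       (\<lambda>(x, y, m0, ms). y) (\<lambda>(x, y, m0, ms). (m0, ms)) (\<lambda>(x, y, m0, ms). (x, m0))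
     = information_gain \<mu> (kernel \<pi>) fst"
    by (rule cond_mutual_info_eq_information_gain[where a = snd and coin = "public_coins \<pi>", OF fin])
      (auto simp: inj_on_def map_fst_transcript execution_eq_joint map_pmf_comp case_prod_unfold)
  ultimately show ?thesis by (simp add: information_cost_def)
qed

definition answer :: "('x, 'y) protocol \<Rightarrow> 'x \<Rightarrow> 'y \<Rightarrow> nat pmf" where
  "answer \<pi> x y = map_pmf (\<lambda>t. last (snd t)) (transcript \<pi> x y)"

lemma computes_with_error_iff:
  "computes_with_error \<pi> X Y g \<epsilon> \<longleftrightarrow> 0 < rounds \<pi> \<and>
    (\<forall>x\<in>X. \<forall>y\<in>Y. measure_pmf.prob (answer \<pi> x y) (- {of_bool (g x y)}) \<le> \<epsilon>)"
proof -
  have "measure_pmf.prob (transcript \<pi> x y) {(m0, ms). last ms = of_bool (g x y)}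
      = 1 - measure_pmf.prob (answer \<pi> x y) (- {of_bool (g x y)})" for x y
  proof -
    have "measure_pmf.prob (transcript \<pi> x y) {(m0, ms). last ms = of_bool (g x y)}
        = measure_pmf.prob (answer \<pi> x y) {of_bool (g x y)}"
      by (auto simp: answer_def intro!: arg_cong2[of _ _ _ _ measure])
    also have "\<dots> = 1 - measure_pmf.prob (answer \<pi> x y) (- {of_bool (g x y)})"
      using measure_pmf.prob_compl[of "{of_bool (g x y)}" "answer \<pi> x y"]
      by (simp add: Compl_eq_Diff_UNIV)
    finally show ?thesis .
  qed
  then show ?thesis unfolding computes_with_error_def by simp
qed

section \<open>The trivial protocol and preprocessing of inputs\<close>

text \<open>The base case for the xor of no bits, whose value is 0. It has one round because an
  output requires a message.\<close>

definition silent :: "('x, 'y) protocol" where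
  "silent = \<lparr>public_coins = return_pmf 0, alice_coins = return_pmf 0, bob_coins = return_pmf 0,
     rounds = 1, alice = \<lambda>_ _ _ _. 0, bob = \<lambda>_ _ _ _. 0\<rparr>"

lemma transcript_silent: "transcript silent x y = return_pmf (0, [0])"
  by (simp add: transcript_def silent_def bind_return_pmf)

lemma information_cost_silent_le:
  fixes \<mu> :: "('x::countable \<times> 'y::countable) pmf"
  assumes "finite (set_pmf \<mu>)"
  shows "information_cost \<mu> silent \<le> 0"
  using information_gain_const_le[OF assms, of "return_pmf (0::nat, [0::nat])" snd]
    information_gain_const_le[OF assms, of "return_pmf (0::nat, [0::nat])" fst]
  by (simp add: information_cost_eq[OF assms] transcript_silent case_prod_unfold)

definition pullback :: "('u \<Rightarrow> 'x) \<Rightarrow> ('v \<Rightarrow> 'y) \<Rightarrow> ('x, 'y) protocol \<Rightarrow> ('u, 'v) protocol" where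
  "pullback f g \<pi> = \<lparr>public_coins = public_coins \<pi>, alice_coins = alice_coins \<pi>,
     bob_coins = bob_coins \<pi>, rounds = rounds \<pi>,
     alice = \<lambda>x. alice \<pi> (f x), bob = \<lambda>y. bob \<pi> (g y)\<rparr>"

lemma messages_pullback:
  "messages (pullback f g \<pi>) x y m0 ra rb k = messages \<pi> (f x) (g y) m0 ra rb k"
  by (induction k) (simp_all add: Let_def pullback_def)

lemma transcript_pullback: "transcript (pullback f g \<pi>) x y = transcript \<pi> (f x) (g y)"
  unfolding transcript_def messages_pullback by (simp add: pullback_def)

lemma answer_pullback: "answer (pullback f g \<pi>) x y = answer \<pi> (f x) (g y)"
  by (simp add: answer_def transcript_pullback)

lemma information_cost_pullback_le:
  fixes \<mu> :: "('u::countable \<times> 'v::countable) pmf"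
    and f :: "'u \<Rightarrow> 'x::countable" and g :: "'v \<Rightarrow> 'y::countable"
  assumes fin: "finite (set_pmf \<mu>)"
  shows "information_cost \<mu> (pullback f g \<pi>) \<le> information_cost (map_pmf (map_prod f g) \<mu>) \<pi>"
proof -
  have "kernel (pullback f g \<pi>) = (\<lambda>s. kernel \<pi> (map_prod f g s))"
    by (auto simp: transcript_pullback)
  moreover have "information_gain \<mu> (\<lambda>s. kernel \<pi> (map_prod f g s)) snd
      \<le> information_gain (map_pmf (map_prod f g) \<mu>) (kernel \<pi>) snd"
    by (rule information_gain_pullback_le[where h = g, OF fin]) auto
  moreover have "information_gain \<mu> (\<lambda>s. kernel \<pi> (map_prod f g s)) fst
      \<le> information_gain (map_pmf (map_prod f g) \<mu>) (kernel \<pi>) fst"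
    by (rule information_gain_pullback_le[where h = f, OF fin]) auto
  ultimately show ?thesis
    using fin by (simp add: information_cost_eq)
qed

section \<open>Combining two independent runs\<close>

text \<open>Runs \<open>\<pi>\<close>, then as many dummy rounds, so that Alice sends the first message of \<open>\<rho>\<close>, and
  finally announces a function of the two answers.\<close>

definition combined_message ::
  "nat \<Rightarrow> nat \<Rightarrow> (nat \<Rightarrow> nat \<Rightarrow> nat) \<Rightarrow> (nat list \<Rightarrow> nat) \<Rightarrow> (nat list \<Rightarrow> nat) \<Rightarrow> nat list \<Rightarrow> nat" where
  "combined_message r r' F u v h =
     (if length h < r then u h
      else if length h < 2 * r then 0
      else if length h < 2 * r + r' then v (drop (2 * r) h)
      else F (last (take r h)) (last (drop (2 * r) h)))"

text \<open>Each pair of independent coins is packed into one number. Either party can send the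
  final message, since both answers occur in the history.\<close>

definition combine ::
  "(nat \<Rightarrow> nat \<Rightarrow> nat) \<Rightarrow> ('x, 'y) protocol \<Rightarrow> ('x, 'y) protocol \<Rightarrow> ('x, 'y) protocol" where
  "combine F \<pi> \<rho> = \<lparr>
     public_coins = map_pmf prod_encode (pair_pmf (public_coins \<pi>) (public_coins \<rho>)),
     alice_coins = map_pmf prod_encode (pair_pmf (alice_coins \<pi>) (alice_coins \<rho>)),
     bob_coins = map_pmf prod_encode (pair_pmf (bob_coins \<pi>) (bob_coins \<rho>)),
     rounds = 2 * rounds \<pi> + rounds \<rho> + 1,
     alice = \<lambda>x r m. combined_message (rounds \<pi>) (rounds \<rho>) F
       (alice \<pi> x (fst (prod_decode r)) (fst (prod_decode m)))
       (alice \<rho> x (snd (prod_decode r)) (snd (prod_decode m))),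
     bob = \<lambda>y r m. combined_message (rounds \<pi>) (rounds \<rho>) F
       (bob \<pi> y (fst (prod_decode r)) (fst (prod_decode m)))
       (bob \<rho> y (snd (prod_decode r)) (snd (prod_decode m)))\<rparr>"

lemma length_messages [simp]: "length (messages \<pi> x y m0 ra rb k) = k"
  by (induction k) (simp_all add: Let_def)

lemma messages_combine:
  fixes \<pi> \<rho> :: "('x, 'y) protocol"
  defines "r \<equiv> rounds \<pi>" and "r' \<equiv> rounds \<rho>"
  shows "messages (combine F \<pi> \<rho>) x y (prod_encode (m, m')) (prod_encode (a, a'))
      (prod_encode (b, b')) (rounds (combine F \<pi> \<rho>))
    = messages \<pi> x y m a b r @ replicate r 0 @ messages \<rho> x y m' a' b' r'
      @ [F (last (messages \<pi> x y m a b r)) (last (messages \<rho> x y m' a' b' r'))]"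
proof -
  let ?M = "messages (combine F \<pi> \<rho>) x y (prod_encode (m, m')) (prod_encode (a, a')) (prod_encode (b, b'))"
  let ?P = "messages \<pi> x y m a b" and ?Q = "messages \<rho> x y m' a' b'"
  have step: "?M (Suc k) = ?M k @ [if even k
      then combined_message r r' F (alice \<pi> x a m) (alice \<rho> x a' m') (?M k)
      else combined_message r r' F (bob \<pi> y b m) (bob \<rho> y b' m') (?M k)]" for k
    by (simp add: Let_def combine_def r_def r'_def)
  have 1: "?M k = ?P k" if "k \<le> r" for k
    using that
  proof (induction k)
    case (Suc k)
    then show ?case unfolding step[of k] by (simp add: combined_message_def Let_def)
  qed simp
  have 2: "?M (r + k) = ?P r @ replicate k 0" if "k \<le> r" for k
    using that
  proof (induction k)
    case (Suc k)
    then have IH: "?M (r + k) = ?P r @ replicate k 0" by simp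
    have "?M (r + Suc k) = ?M (r + k) @ [0]"
      using Suc.prems unfolding add_Suc_right step[of "r + k"]
      by (simp add: combined_message_def)
    then show ?case by (simp add: IH replicate_append_same)
  qed (simp add: 1)
  \<comment> \<open>The offset \<open>2 * r\<close> is even, so at step \<open>2 * r + k\<close> the
    speaker is the one who speaks at step \<open>k\<close> of \<rho>.\<close>
  have 3: "?M (2 * r + k) = ?P r @ replicate r 0 @ ?Q k" if "k \<le> r'" for k
    using that
  proof (induction k)
    case 0
    then show ?case using 2[of r] by (simp add: mult_2)
  next
    case (Suc k)
    then have IH: "?M (2 * r + k) = ?P r @ replicate r 0 @ ?Q k" by simp
    have "drop (2 * r) (?M (2 * r + k)) = ?Q k" unfolding IH by simp
    then have "?M (2 * r + Suc k) = ?M (2 * r + k) @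
        [if even k then alice \<rho> x a' m' (?Q k) else bob \<rho> y b' m' (?Q k)]"
      using Suc.prems unfolding add_Suc_right step[of "2 * r + k"]
      by (simp add: combined_message_def)
    then show ?case by (simp add: IH Let_def)
  qed
  have IH: "?M (2 * r + r') = ?P r @ replicate r 0 @ ?Q r'" by (rule 3) simp
  have "take r (?M (2 * r + r')) = ?P r" "drop (2 * r) (?M (2 * r + r')) = ?Q r'"
    unfolding IH by simp_all
  then have "?M (Suc (2 * r + r')) = ?M (2 * r + r') @ [F (last (?P r)) (last (?Q r'))]"
    unfolding step by (simp add: combined_message_def)
  moreover have "rounds (combine F \<pi> \<rho>) = Suc (2 * r + r')"
    by (simp add: combine_def r_def r'_def)
  ultimately show ?thesis by (simp add: IH)
qed

definition combined_transcript ::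
  "nat \<Rightarrow> (nat \<Rightarrow> nat \<Rightarrow> nat) \<Rightarrow> (nat \<times> nat list) \<times> (nat \<times> nat list) \<Rightarrow> nat \<times> nat list" where
  "combined_transcript r F = (\<lambda>((m, ms), (m', ms')).
     (prod_encode (m, m'), ms @ replicate r 0 @ ms' @ [F (last ms) (last ms')]))"

text \<open>Two separate runs group their coins by protocol, the combined protocol groups them by
  kind. Independence makes the two groupings agree up to reordering.\<close>

lemma pair_pmf_triple_regroup:
  fixes P :: "'a pmf" and A :: "'b pmf" and B :: "'c pmf"
    and P' :: "'d pmf" and A' :: "'e pmf" and B' :: "'f pmf"
  shows
  "pair_pmf (pair_pmf P (pair_pmf A B)) (pair_pmf P' (pair_pmf A' B'))
    = map_pmf (\<lambda>((m, m'), (a, a'), (b, b')). ((m, a, b), (m', a', b')))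
        (pair_pmf (pair_pmf P P') (pair_pmf (pair_pmf A A') (pair_pmf B B')))"
  (is "?L = map_pmf ?\<phi> ?R")
proof (rule pmf_eqI)
  fix z :: "('a \<times> 'b \<times> 'c) \<times> ('d \<times> 'e \<times> 'f)"
  obtain m a b m' a' b' where z: "z = ((m, a, b), (m', a', b'))" by (metis prod.exhaust)
  have "inj ?\<phi>" by (auto simp: inj_on_def)
  from pmf_map_inj'[OF this, of ?R "((m, m'), (a, a'), (b, b'))"]
  show "pmf ?L z = pmf (map_pmf ?\<phi> ?R) z" by (simp add: z pmf_pair)
qed

text \<open>On each fixed input the combined transcript is an image of two independent transcripts,
  which is the form that \<open>information_gain_pair_le\<close> needs.\<close>

lemma transcript_combine:
  "transcript (combine F \<pi> \<rho>) x y
    = map_pmf (combined_transcript (rounds \<pi>) F) (pair_pmf (transcript \<pi> x y) (transcript \<rho> x y))"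
proof -
  have run: "run (combine F \<pi> \<rho>) x y (prod_encode (m, m'), prod_encode (a, a'), prod_encode (b, b'))
      = combined_transcript (rounds \<pi>) F (run \<pi> x y (m, a, b), run \<rho> x y (m', a', b'))"
    for m m' a a' b b'
    by (simp add: run_def combined_transcript_def messages_combine)
  note map_prod = map_pair[folded map_prod_def, symmetric]
  let ?\<phi> = "\<lambda>((m, m'), (a, a'), (b, b')). ((m, a, b), (m', a', b'))"
  let ?R = "pair_pmf (pair_pmf (public_coins \<pi>) (public_coins \<rho>))
    (pair_pmf (pair_pmf (alice_coins \<pi>) (alice_coins \<rho>)) (pair_pmf (bob_coins \<pi>) (bob_coins \<rho>)))"
  have "pair_pmf (transcript \<pi> x y) (transcript \<rho> x y)
      = map_pmf (map_prod (run \<pi> x y) (run \<rho> x y)) (map_pmf ?\<phi> ?R)"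
    unfolding transcript_eq_run map_prod pair_pmf_triple_regroup ..
  moreover have "transcript (combine F \<pi> \<rho>) x y
      = map_pmf (run (combine F \<pi> \<rho>) x y) (map_pmf (map_prod prod_encode (map_prod prod_encode prod_encode)) ?R)"
    unfolding transcript_eq_run map_prod[symmetric] by (simp add: combine_def)
  ultimately show ?thesis
    by (simp only: map_pmf_comp) (auto intro!: map_pmf_cong simp: run)
qed

lemma rounds_combine_pos: "0 < rounds (combine F \<pi> \<rho>)"
  by (simp add: combine_def)

lemma answer_combine:
  "answer (combine F \<pi> \<rho>) x y
    = map_pmf (\<lambda>(b, b'). F b b') (pair_pmf (answer \<pi> x y) (answer \<rho> x y))"
proof -
  have "pair_pmf (answer \<pi> x y) (answer \<rho> x y)
      = map_pmf (map_prod (\<lambda>t. last (snd t)) (\<lambda>t. last (snd t)))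
          (pair_pmf (transcript \<pi> x y) (transcript \<rho> x y))"
    unfolding answer_def by (rule map_pair[folded map_prod_def, symmetric])
  then show ?thesis
    unfolding answer_def[of "combine F \<pi> \<rho>"] transcript_combine
    by (simp add: map_pmf_comp) (auto intro!: map_pmf_cong simp: combined_transcript_def)
qed

lemma information_cost_combine_le:
  fixes \<mu> :: "('x::countable \<times> 'y::countable) pmf"
  assumes fin: "finite (set_pmf \<mu>)"
  shows "information_cost \<mu> (combine F \<pi> \<rho>) \<le> information_cost \<mu> \<pi> + information_cost \<mu> \<rho>"
proof -
  have "kernel (combine F \<pi> \<rho>)
      = (\<lambda>s. map_pmf (combined_transcript (rounds \<pi>) F) (pair_pmf (kernel \<pi> s) (kernel \<rho> s)))"
    by (auto simp: transcript_combine)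
  then show ?thesis
    using information_gain_pair_le[OF fin, of "combined_transcript (rounds \<pi>) F" "kernel \<pi>" "kernel \<rho>" snd]
      information_gain_pair_le[OF fin, of "combined_transcript (rounds \<pi>) F" "kernel \<pi>" "kernel \<rho>" fst]
    by (simp add: information_cost_eq[OF fin])
qed

section \<open>Error reduction by majority voting\<close>

text \<open>As \<open>combine\<close> joins only two protocols, the inner one announces the number
  of ones among two votes, and the outer one adds the third vote and compares with 2.\<close>

definition majority_of_3 :: "('x, 'y) protocol \<Rightarrow> ('x, 'y) protocol" where
  "majority_of_3 \<pi> = combine (\<lambda>a c. of_bool (of_bool (a = 1) + c \<ge> 2)) \<pi>
     (combine (\<lambda>a b. of_bool (a = 1) + of_bool (b = 1)) \<pi> \<pi>)"

lemma answer_majority_of_3: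
  "answer (majority_of_3 \<pi>) x y
    = map_pmf (\<lambda>(a, b, c). of_bool (of_bool (a = 1) + (of_bool (b = 1) + of_bool (c = 1)) \<ge> (2::nat)))
       (pair_pmf (answer \<pi> x y) (pair_pmf (answer \<pi> x y) (answer \<pi> x y)))"
  by (simp add: majority_of_3_def answer_combine pair_map_pmf2 map_pmf_comp case_prod_unfold)

lemma majority_error_le:
  fixes e :: real
  assumes "0 \<le> e" "e \<le> 1 / 3"
  shows "e * (1 - (1 - e) * (1 - e)) + (1 - e) * (e * e) \<le> 7 / 9 * e"
proof -
  \<comment> \<open>The left side of the claim equals \<open>e * (3 * e - 2 * e * e)\<close>, and
    \<open>7 / 9 - 3 * e + 2 * e * e\<close> factors as shown. Equality holds at
    \<open>e = 1 / 3\<close>.\<close>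
  have "0 \<le> (1 / 3 - e) * (7 / 3 - 2 * e)"
    using assms by (intro mult_nonneg_nonneg) auto
  then have "3 * e - 2 * e * e \<le> 7 / 9"
    by (simp add: field_simps)
  then have "e * (3 * e - 2 * e * e) \<le> e * (7 / 9)"
    using assms by (intro mult_left_mono)
  then show ?thesis by (simp add: algebra_simps)
qed

lemma error_majority_of_3_le:
  fixes v :: bool
  defines "error \<equiv> \<lambda>\<pi>::('x, 'y) protocol. \<lambda>x y. measure_pmf.prob (answer \<pi> x y) (- {of_bool v})"
  assumes le: "error \<pi> x y \<le> 1 / 3"
  shows "error (majority_of_3 \<pi>) x y \<le> 7 / 9 * error \<pi> x y"
proof -
  let ?p = "answer \<pi> x y" and ?G = "{of_bool v} :: nat set" and ?e = "error \<pi> x y"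
  let ?q = "pair_pmf ?p (pair_pmf ?p ?p)"
  have good: "measure_pmf.prob ?p ?G = 1 - ?e"
    using measure_pmf.prob_compl[of ?G ?p] by (simp add: error_def Compl_eq_Diff_UNIV)
  have comp: "measure_pmf.prob (pair_pmf ?p ?p) (- (?G \<times> ?G)) = 1 - (1 - ?e) * (1 - ?e)"
    using measure_pmf.prob_compl[of "?G \<times> ?G" "pair_pmf ?p ?p"]
    by (simp only: Compl_eq_Diff_UNIV)
      (simp add: measure_pmf_prob_product good del: insert_Times_insert)
  \<comment> \<open>Either the first vote is wrong and the others are not both right, or the first
    is right and both others are wrong. This is only an inclusion, since every answer other than 1
    counts as a vote for 0 and a wrong answer may thus do no damage.\<close>
  have "error (majority_of_3 \<pi>) x y
      \<le> measure_pmf.prob ?q ((- ?G) \<times> (- (?G \<times> ?G)) \<union> ?G \<times> (- ?G) \<times> (- ?G))"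
    unfolding error_def answer_majority_of_3 measure_map_pmf
    by (intro measure_pmf.finite_measure_mono) (auto simp: of_bool_def split: if_splits)
  also have "\<dots> \<le> measure_pmf.prob ?q ((- ?G) \<times> (- (?G \<times> ?G)))
      + measure_pmf.prob ?q (?G \<times> (- ?G) \<times> (- ?G))"
    by (intro measure_Un_le) auto
  also have "\<dots> = ?e * (1 - (1 - ?e) * (1 - ?e)) + (1 - ?e) * (?e * ?e)"
    by (simp only: measure_pmf_prob_product countableI_type comp good)
      (simp add: error_def)
  also have "\<dots> \<le> 7 / 9 * ?e"
    using le by (intro majority_error_le) (auto simp: error_def)
  finally show ?thesis .
qed

lemma computes_with_error_majority_of_3:
  assumes "computes_with_error \<pi> X Y g \<epsilon>" "\<epsilon> \<le> 1 / 3"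
  shows "computes_with_error (majority_of_3 \<pi>) X Y g (7 / 9 * \<epsilon>)"
proof -
  have "measure_pmf.prob (answer (majority_of_3 \<pi>) x y) (- {of_bool (g x y)}) \<le> 7 / 9 * \<epsilon>"
    if "x \<in> X" "y \<in> Y" for x y
  proof -
    have "measure_pmf.prob (answer \<pi> x y) (- {of_bool (g x y)}) \<le> \<epsilon>"
      using assms(1) that by (auto simp: computes_with_error_iff)
    then show ?thesis
      using error_majority_of_3_le[of \<pi> x y "g x y"] assms(2) by linarith
  qed
  then show ?thesis
    by (simp add: computes_with_error_iff majority_of_3_def rounds_combine_pos)
qed

lemma computes_with_error_iterate_majority:
  assumes "computes_with_error \<pi> X Y g \<epsilon>" "0 \<le> \<epsilon>" "\<epsilon> \<le> 1 / 3"
  shows "computes_with_error ((majority_of_3 ^^ k) \<pi>) X Y g ((7 / 9) ^ k * \<epsilon>)"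
proof (induction k)
  case (Suc k)
  \<comment> \<open>The error stays at most \<open>1 / 3\<close>, so the next level of voting
    applies.\<close>
  have "(7 / 9) ^ k * \<epsilon> \<le> 1 * \<epsilon>"
    using assms(2) by (intro mult_right_mono power_le_one) auto
  then show ?case
    using computes_with_error_majority_of_3[OF Suc] assms(3) by (simp add: mult.assoc)
qed (simp add: assms)

text \<open>Each level uses three runs of the level below on the same inputs, so subadditivity at
  most triples the cost.\<close>

lemma information_cost_iterate_majority_le:
  fixes \<mu> :: "('x::countable \<times> 'y::countable) pmf"
  assumes fin: "finite (set_pmf \<mu>)"
  shows "information_cost \<mu> ((majority_of_3 ^^ k) \<pi>) \<le> 3 ^ k * information_cost \<mu> \<pi>"
proof (induction k)
  case (Suc k)
  have "information_cost \<mu> (majority_of_3 \<rho>) \<le> 3 * information_cost \<mu> \<rho>" for \<rho> :: "('x, 'y) protocol"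
    unfolding majority_of_3_def
    using information_cost_combine_le[OF fin, of "\<lambda>a c. of_bool (of_bool (a = 1) + c \<ge> 2)" \<rho>
        "combine (\<lambda>a b. of_bool (a = 1) + of_bool (b = 1)) \<rho> \<rho>"]
      information_cost_combine_le[OF fin, of "\<lambda>a b. of_bool (a = 1) + of_bool (b = 1)" \<rho> \<rho>]
    by linarith
  from this[of "(majority_of_3 ^^ k) \<pi>"] show ?case using Suc by simp
qed simp

section \<open>Solving the coordinates one after another\<close>

primrec xor_protocol :: "('x, 'y) protocol \<Rightarrow> nat \<Rightarrow> ('x list, 'y list) protocol" where
  "xor_protocol \<pi> 0 = silent"
| "xor_protocol \<pi> (Suc n) = combine (\<lambda>a b. of_bool ((a = 1) \<noteq> (b = 1)))
     (pullback hd hd \<pi>) (pullback tl tl (xor_protocol \<pi> n))"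

lemma tuples_Suc: "xs \<in> tuples X (Suc n) \<longleftrightarrow> (\<exists>x xs'. xs = x # xs' \<and> x \<in> X \<and> xs' \<in> tuples X n)"
  by (cases xs) (auto simp: tuples_def)

lemma finite_tuples: "finite X \<Longrightarrow> finite (tuples X n)"
  using finite_lists_length_eq[of X n] by (simp add: tuples_def conj_commute)

text \<open>A union bound: the announced xor can be wrong only if the head run or the tail run
  errs.\<close>

lemma computes_with_error_xor_protocol:
  assumes "computes_with_error \<pi> X Y f \<epsilon>"
  shows "computes_with_error (xor_protocol \<pi> n) (tuples X n) (tuples Y n) (xor_power f) (n * \<epsilon>)"
proof (induction n)
  case 0
  then show ?case
    by (simp add: computes_with_error_iff answer_def transcript_silent tuples_def xor_power_def)
      (simp add: silent_def)
next
  case (Suc n)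
  have "measure_pmf.prob (answer (xor_protocol \<pi> (Suc n)) (x # xs) (y # ys))
      (- {of_bool (xor_power f (x # xs) (y # ys))}) \<le> Suc n * \<epsilon>"
    if "x \<in> X" "y \<in> Y" "xs \<in> tuples X n" "ys \<in> tuples Y n" for x y xs ys
  proof -
    let ?p = "answer \<pi> x y" and ?q = "answer (xor_protocol \<pi> n) xs ys"
    let ?A = "{of_bool (f x y)} :: nat set" and ?B = "{of_bool (xor_power f xs ys)} :: nat set"
    have p: "measure_pmf.prob ?p (- ?A) \<le> \<epsilon>"
      using assms that by (auto simp: computes_with_error_iff)
    have q: "measure_pmf.prob ?q (- ?B) \<le> n * \<epsilon>"
      using Suc that by (auto simp: computes_with_error_iff)
    have xor: "xor_power f (x # xs) (y # ys) = (f x y \<noteq> xor_power f xs ys)"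
      by (simp add: xor_power_def)
    have "measure_pmf.prob (answer (xor_protocol \<pi> (Suc n)) (x # xs) (y # ys))
        (- {of_bool (xor_power f (x # xs) (y # ys))})
        \<le> measure_pmf.prob (pair_pmf ?p ?q) ((- ?A) \<times> UNIV \<union> UNIV \<times> (- ?B))"
      unfolding xor xor_protocol.simps answer_combine answer_pullback measure_map_pmf list.sel
      by (intro measure_pmf.finite_measure_mono) auto
    also have "\<dots> \<le> measure_pmf.prob (pair_pmf ?p ?q) ((- ?A) \<times> UNIV)
        + measure_pmf.prob (pair_pmf ?p ?q) (UNIV \<times> (- ?B))"
      by (intro measure_Un_le) auto
    also have "\<dots> = measure_pmf.prob ?p (- ?A) + measure_pmf.prob ?q (- ?B)"
      by (simp add: measure_pmf_prob_product)
    finally show ?thesis using p q by (simp add: algebra_simps)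
  qed
  moreover have "0 < rounds (xor_protocol \<pi> (Suc n))"
    by (simp add: rounds_combine_pos)
  ultimately show ?case
    unfolding computes_with_error_iff by (metis tuples_Suc)
qed

text \<open>The coordinates may be correlated under \<mu>. Only its images under \<open>hd\<close>
  and \<open>tl\<close> enter, and \<open>s\<close> bounds the cost of \<pi> for every law on the
  inputs.\<close>

lemma information_cost_xor_protocol_le:
  fixes X :: "'x::countable set" and Y :: "'y::countable set"
  assumes fin: "finite X" "finite Y"
    and le: "\<And>\<nu>. set_pmf \<nu> \<subseteq> X \<times> Y \<Longrightarrow> information_cost \<nu> \<pi> \<le> s"
    and \<mu>: "set_pmf \<mu> \<subseteq> tuples X n \<times> tuples Y n"
  shows "information_cost \<mu> (xor_protocol \<pi> n) \<le> n * s"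
  using \<mu>
proof (induction n arbitrary: \<mu>)
  case 0
  have "finite (set_pmf \<mu>)"
    by (rule finite_subset[OF 0]) (intro finite_cartesian_product finite_tuples fin)
  then show ?case using information_cost_silent_le by simp
next
  case (Suc n)
  have fin\<mu>: "finite (set_pmf \<mu>)"
    by (rule finite_subset[OF Suc.prems]) (intro finite_cartesian_product finite_tuples fin)
  have "information_cost \<mu> (xor_protocol \<pi> (Suc n))
      \<le> information_cost \<mu> (pullback hd hd \<pi>) + information_cost \<mu> (pullback tl tl (xor_protocol \<pi> n))"
    using information_cost_combine_le[OF fin\<mu>] by simp
  also have "\<dots> \<le> information_cost (map_pmf (map_prod hd hd) \<mu>) \<pi>
      + information_cost (map_pmf (map_prod tl tl) \<mu>) (xor_protocol \<pi> n)"
    by (intro add_mono information_cost_pullback_le fin\<mu>)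
  also have "\<dots> \<le> s + n * s"
    using Suc.prems by (intro add_mono le Suc.IH) (fastforce simp: tuples_Suc)+
  finally show ?case by (simp add: algebra_simps)
qed

section \<open>The constants and the passage to the infimum\<close>

text \<open>The number \<open>n\<close> cancels, and \<open>(7 / 9) ^ 10\<close> is about 0.081.
  Nine levels would leave about 0.104.\<close>

lemma amplified_error_le:
  assumes "n \<ge> (1::nat)"
  shows "n * ((7 / 9) ^ 10 * (1 / real n)) \<le> 1 / 10"
  using assms by (simp add: eval_nat_numeral)

theorem theorem2:
  shows "\<exists>c\<^sub>2::real. c\<^sub>2 > 0 \<and>
    (\<forall>(X::nat set) (Y::nat set) (f::nat \<Rightarrow> nat \<Rightarrow> bool) (n::nat).
       finite X \<longrightarrow> finite Y \<longrightarrow> X \<noteq> {} \<longrightarrow> Y \<noteq> {} \<longrightarrow> n \<ge> 3 \<longrightarrow>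
       information_complexity (tuples X n) (tuples Y n) (xor_power f) (1 / 10)
         \<le> ereal (c\<^sub>2 * real n) * information_complexity X Y f (1 / real n))"
proof (intro exI[of _ "3 ^ 10"] conjI allI impI)
  fix X Y :: "nat set" and f :: "nat \<Rightarrow> nat \<Rightarrow> bool" and n :: nat
  assume fin: "finite X" "finite Y" and ne: "X \<noteq> {}" "Y \<noteq> {}" and n: "n \<ge> 3"
  let ?L = "information_complexity (tuples X n) (tuples Y n) (xor_power f) (1 / 10)"
  let ?cost = "\<lambda>\<pi>. SUP \<mu>\<in>{\<mu>. set_pmf \<mu> \<subseteq> X \<times> Y}. ereal (information_cost \<mu> \<pi>)"
  \<comment> \<open>Ten levels of voting, each tripling the cost, account for \<open>3 ^ 10\<close>,
    and the coordinates account for \<open>n\<close>.\<close>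
  define c where "c = 3 ^ 10 * real n"
  have c: "c > 0" using n by (simp add: c_def)
  have "?L \<le> ereal c * ?cost \<pi>" if \<pi>: "computes_with_error \<pi> X Y f (1 / real n)" for \<pi>
  proof (cases "?cost \<pi>")
    case PInf
    then show ?thesis using c by simp
  next
    case MInf
    \<comment> \<open>This case is impossible: a point mass on some input pair gives a real lower
      bound for the supremum.\<close>
    obtain x y where "x \<in> X" "y \<in> Y" using ne by blast
    then have "ereal (information_cost (return_pmf (x, y)) \<pi>) \<le> ?cost \<pi>"
      by (intro SUP_upper) auto
    then show ?thesis unfolding MInf by simp
  next
    case (real s)
    define \<rho> where "\<rho> = (majority_of_3 ^^ 10) \<pi>"
    have le: "information_cost \<nu> \<rho> \<le> 3 ^ 10 * s" if \<nu>: "set_pmf \<nu> \<subseteq> X \<times> Y" for \<nu>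
    proof -
      have "ereal (information_cost \<nu> \<pi>) \<le> ?cost \<pi>"
        using \<nu> by (intro SUP_upper) auto
      then have "information_cost \<nu> \<pi> \<le> s" by (simp add: real)
      moreover have "finite (set_pmf \<nu>)" by (rule finite_subset[OF \<nu>]) (intro finite_cartesian_product fin)
      then have "information_cost \<nu> \<rho> \<le> 3 ^ 10 * information_cost \<nu> \<pi>"
        unfolding \<rho>_def by (rule information_cost_iterate_majority_le)
      ultimately show ?thesis by simp
    qed
    \<comment> \<open>Here \<open>n \<ge> 3\<close> provides the initial error bound
      \<open>1 / real n \<le> 1 / 3\<close>.\<close>
    have "computes_with_error \<rho> X Y f ((7 / 9) ^ 10 * (1 / real n))"
      unfolding \<rho>_def using n by (intro computes_with_error_iterate_majority \<pi>) (auto simp: field_simps)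
    then have "computes_with_error (xor_protocol \<rho> n) (tuples X n) (tuples Y n) (xor_power f)
        (n * ((7 / 9) ^ 10 * (1 / real n)))"
      by (rule computes_with_error_xor_protocol)
    then have "computes_with_error (xor_protocol \<rho> n) (tuples X n) (tuples Y n) (xor_power f) (1 / 10)"
      using amplified_error_le[of n] n unfolding computes_with_error_iff by (force intro: order_trans)
    then have "?L \<le> (SUP \<mu>\<in>{\<mu>. set_pmf \<mu> \<subseteq> tuples X n \<times> tuples Y n}.
        ereal (information_cost \<mu> (xor_protocol \<rho> n)))"
      unfolding information_complexity_def by (intro INF_lower) auto
    also have "\<dots> \<le> ereal (n * (3 ^ 10 * s))"
      using information_cost_xor_protocol_le[OF fin le] by (intro SUP_least) auto
    also have "\<dots> = ereal c * ?cost \<pi>"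
      unfolding real by (simp add: c_def)
    finally show ?thesis .
  qed
  \<comment> \<open>Dividing by the positive real \<open>c\<close> makes \<open>?L / ereal c\<close>
    a lower bound for the cost of every admissible protocol, hence for the infimum.\<close>
  then have "?L / ereal c \<le> information_complexity X Y f (1 / real n)"
    unfolding information_complexity_def[of X Y] using c
    by (intro INF_greatest) (auto simp: ereal_divide_le_pos)
  then show "?L \<le> ereal (3 ^ 10 * real n) * information_complexity X Y f (1 / real n)"
    using c by (simp add: ereal_divide_le_pos c_def)
qed simp

end
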